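(* Let $\kappa\ge 1$. For any $k$ and any $n\ge \Omega_\kappa(\log k)$, let $\mathcal C=\mathrm{Lift}_n(\mathrm{MAJ}_k)$. Then: (a) there is a learning algorithm using $O(2^n)$ samples which, for every $\kappa$-smooth distribution $\mathcal D$ on $\{-1,1\}^{kn}$ and every $F\in\mathcal C$, given i.i.d. samples $(\mathbf X,F(\mathbf X))$ with $\mathbf X\sim\mathcal D$, with high probability outputs a hypothesis $h:\{-1,1\}^{kn}\to\{-1,1\}$ with advantage $\mathbb E_{\mathbf X\sim\mathcal D}[h(\mathbf X)F(\mathbf X)]\ge \Omega\big(1/\sqrt{k\log k\,\kappa^7}\big)$; (b) any algorithm that learns $\mathcal C$ to accuracy $0.99$ with respect to the uniform distribution on $\{-1,1\}^{kn}$ (i.e., for every $F\in\mathcal C$, given i.i.d. uniform samples labeled by $F$, with high probability outputs $h$ with $\Pr_{\mathbf X}[h(\mathbf X)=F(\mathbf X)]\ge 0.99$) requires $\Omega(k2^n)$ samples.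
   Context: $\{-1,1\}$-valued Boolean functions. $\mathrm{MAJ}_k(x)=\mathrm{sign}(\sum_{i=1}^k x_i)$ for $x\in\{-1,1\}^k$, where $\mathrm{sign}(t)=1$ if $t\ge0$ and $-1$ otherwise. A function $f:\{-1,1\}^n\to\{-1,1\}$ is balanced if it outputs $1$ and $-1$ on equally many inputs. For $g:\{-1,1\}^k\to\{-1,1\}$, $\mathrm{Lift}_n(g)$ is the set of functions $F:\{-1,1\}^{nk}\to\{-1,1\}$ of the form $F(X)=g(f_1(X^{(1)}),\dots,f_k(X^{(k)}))$, where $X=(X^{(1)},\dots,X^{(k)})$ with each block $X^{(i)}\in\{-1,1\}^n$ and each $f_i:\{-1,1\}^n\to\{-1,1\}$ is balanced. A distribution $\mathcal D$ on a finite set $\mathcal X$ is $\kappa$-smooth if $\mathcal D(x)\le \kappa/|\mathcal X|$ for all $x$. $\Omega_\kappa$ hides a constant depending on $\kappa$. *)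

theory Defs
  imports "HOL-Probability.Probability"
begin

type_synonym point = "nat \<Rightarrow> int"
type_synonym bfun = "point \<Rightarrow> int"

(* Points and Boolean functions are extensional (undefined off their domain),
   so each of them has exactly one representation and both sets below are finite. *)

definition cube :: "nat \<Rightarrow> point set" where
  "cube d = {..<d} \<rightarrow>\<^sub>E {-1, 1}"

definition bool_fun :: "nat \<Rightarrow> bfun set" where
  "bool_fun d = cube d \<rightarrow>\<^sub>E {-1, 1}"

definition balanced :: "nat \<Rightarrow> bfun \<Rightarrow> bool" where
  "balanced n f \<longleftrightarrow> f \<in> bool_fun n \<and>
     card {x \<in> cube n. f x = 1} = card {x \<in> cube n. f x = -1}"

(* Unlike the library's sgn, the value at 0 is 1. *)
definition sign_pm :: "int \<Rightarrow> int" where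
  "sign_pm t = (if t \<ge> 0 then 1 else -1)"

definition majority :: "nat \<Rightarrow> bfun" where
  "majority k = (\<lambda>x \<in> cube k. sign_pm (\<Sum>i<k. x i))"

(* Coordinate j of block i is coordinate i * n + j; blocks are numbered from 0. *)
definition block :: "nat \<Rightarrow> point \<Rightarrow> nat \<Rightarrow> point" where
  "block n X i = (\<lambda>j \<in> {..<n}. X (i * n + j))"

definition Lift :: "nat \<Rightarrow> nat \<Rightarrow> bfun \<Rightarrow> bfun set" where
  "Lift n k g =
     {(\<lambda>X \<in> cube (k * n). g (\<lambda>i \<in> {..<k}. f i (block n X i))) | f. \<forall>i<k. balanced n (f i)}"

definition smooth :: "real \<Rightarrow> 'a set \<Rightarrow> 'a pmf \<Rightarrow> bool" where
  "smooth \<kappa> S D \<longleftrightarrow> set_pmf D \<subseteq> S \<and> (\<forall>x\<in>S. pmf D x \<le> \<kappa> / real (card S))"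

(* A possibly randomized learner maps a labeled sample to a distribution over hypotheses.
   There is no computational restriction: only the number of samples is measured. *)
type_synonym learner = "(point \<times> int) list \<Rightarrow> bfun pmf"

definition is_learner :: "nat \<Rightarrow> learner \<Rightarrow> bool" where
  "is_learner d A \<longleftrightarrow> (\<forall>S. set_pmf (A S) \<subseteq> bool_fun d)"

(* Distribution of the output of A on m independent draws from D labeled by F;
   it covers both the sample and the internal randomness of A. *)
definition output_pmf :: "learner \<Rightarrow> nat \<Rightarrow> point pmf \<Rightarrow> bfun \<Rightarrow> bfun pmf" where
  "output_pmf A m D F =
     bind_pmf (replicate_pmf m D) (\<lambda>xs. A (map (\<lambda>x. (x, F x)) xs))"

definition advantage :: "point pmf \<Rightarrow> bfun \<Rightarrow> bfun \<Rightarrow> real" where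
  "advantage D F h = measure_pmf.expectation D (\<lambda>x. real_of_int (h x * F x))"

definition accuracy :: "point pmf \<Rightarrow> bfun \<Rightarrow> bfun \<Rightarrow> real" where
  "accuracy D F h = measure_pmf.prob D {x. h x = F x}"

(* log k for k \<ge> 2; at k = 1, where log k = 0 would put a zero in a denominator,
   it is read as log 2. *)
definition lg :: "nat \<Rightarrow> real" where
  "lg k = log 2 (real (max 2 k))"

end

theory Submission
  imports Defs "HOL-Combinatorics.Transposition"
begin

text \<open>
  Upper bound. From a first sample of size \<open>2 ^ n\<close>, let \<open>T i z\<close> be the label of the first point whose
  block \<open>i\<close> is \<open>z\<close> (\<open>0\<close> if there is none), and let every block vote by \<open>T i\<close>. The mean of \<open>T i z\<close> is
  \<open>q i z * hit i z\<close>, where \<open>q i z\<close> is the integral of \<open>F\<close> over the points with block \<open>i\<close> equal to \<open>z\<close>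
  and \<open>hit i z\<close> lies between \<open>2 ^ n / (4 \<kappa>)\<close> and \<open>2 ^ n\<close>, so the total vote has correlation about
  \<open>\<Sum> q\<^sup>2 hit\<close> with \<open>F\<close>. By Cauchy-Schwarz this sum is at least of order
  \<open>(E \<bar>f\<^sub>1 + \<dots> + f\<^sub>k\<bar>)\<^sup>2 / (k \<kappa>)\<close>, and a small-ball estimate for the simple random walk bounds the
  expectation below by \<open>sqrt k / \<kappa>\<close> up to a constant factor. Given the sample, the vote of a uniform
  point is a sum of \<open>k\<close> independent bounded terms, so up to a negligible tail it lies within
  \<open>sqrt (k log k \<kappa>)\<close> of its mean. Recentring the vote costs little unless \<open>E F\<close> is so large that a
  constant hypothesis suffices, hence some threshold of the vote has the required advantage. A second
  sample of size \<open>2 ^ n\<close> selects the threshold.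

  Lower bound. If \<open>\<rho>\<^sub>i\<close> is the correlation of \<open>f\<^sub>i\<close> and \<open>g\<^sub>i\<close>, then the correlation of
  \<open>MAJ(f)\<close> and \<open>MAJ(g)\<close> is \<open>\<Sum>\<^sub>A (\<Prod>\<^sub>i\<^sub>\<in>\<^sub>A \<rho>\<^sub>i) m(A)\<^sup>2\<close> with the Fourier coefficients \<open>m\<close> of
  majority. A constant fraction of the Fourier weight is on the singletons, so two targets with a common
  0.99-accurate hypothesis have truth tables \<open>(f\<^sub>1, \<dots>, f\<^sub>k)\<close> at relative Hamming distance at most
  0.08. Hence one hypothesis serves at most \<open>2 powr (k 2 ^ n / 2)\<close> of the nearly \<open>2 ^ (k 2 ^ n)\<close>
  targets, whereas \<open>m\<close> labels carry only \<open>m\<close> bits.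
\<close>

section \<open>Sums over the cube\<close>

lemma finite_cube [simp]: "finite (cube d)"
  by (simp add: cube_def finite_PiE)

lemma card_cube [simp]: "card (cube d) = 2 ^ d"
  by (simp add: cube_def card_PiE numeral_2_eq_2)

lemma cube_nonempty [simp]: "cube d \<noteq> {}"
  by (simp add: cube_def PiE_eq_empty_iff)

lemma block_in_cube:
  assumes "X \<in> cube (k * n)" "i < k"
  shows "block n X i \<in> cube n"
proof -
  have "i * n + j < k * n" if "j < n" for j
  proof -
    have "i * n + j < Suc i * n" using that by simp
    also have "\<dots> \<le> k * n" using assms(2) by (intro mult_le_mono1) simp
    finally show ?thesis .
  qed
  then show ?thesis
    using assms(1) by (auto simp: cube_def block_def PiE_iff)
qed

text \<open>Division with remainder by \<open>n\<close> splits a coordinate of the long point into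
  block number and offset, which gives the explicit inverse \<open>?g\<close>.\<close>

lemma bij_betw_blocks:
  "bij_betw (\<lambda>X. \<lambda>i\<in>{..<k}. block n X i) (cube (k * n)) ({..<k} \<rightarrow>\<^sub>E cube n)"
proof (rule bij_betwI)
  let ?g = "\<lambda>Y. \<lambda>j\<in>{..<k * n}. Y (j div n) (j mod n)"
  have lt: "i * n + j < k * n" if "i < k" "j < n" for i j
  proof -
    have "i * n + j < Suc i * n" using that by simp
    also have "\<dots> \<le> k * n" using that by (intro mult_le_mono1) simp
    finally show ?thesis .
  qed
  have divmod: "j div n < k" "j mod n < n" if "j < k * n" for j
  proof -
    have "0 < n" using that by (cases n) auto
    then show "j div n < k" "j mod n < n"
      using that by (auto simp: less_mult_imp_div_less)
  qed
  show "(\<lambda>X. \<lambda>i\<in>{..<k}. block n X i) \<in> cube (k * n) \<rightarrow> {..<k} \<rightarrow>\<^sub>E cube n"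
    using block_in_cube by auto
  show "?g \<in> ({..<k} \<rightarrow>\<^sub>E cube n) \<rightarrow> cube (k * n)"
  proof
    fix Y assume Y: "Y \<in> {..<k} \<rightarrow>\<^sub>E cube n"
    have "Y (j div n) (j mod n) \<in> {-1, 1}" if "j < k * n" for j
    proof -
      have "Y (j div n) \<in> cube n" using Y divmod[OF that] by auto
      then show ?thesis using divmod[OF that] unfolding cube_def by auto
    qed
    then show "?g Y \<in> cube (k * n)" by (auto simp: cube_def)
  qed
  show "?g (\<lambda>i\<in>{..<k}. block n X i) = X" if "X \<in> cube (k * n)" for X
  proof
    fix j
    show "?g (\<lambda>i\<in>{..<k}. block n X i) j = X j"
    proof (cases "j < k * n")
      case True
      then show ?thesis using divmod[OF True] by (simp add: block_def)
    next
      case False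
      then have "X j = undefined" using that by (auto simp: cube_def PiE_def extensional_def)
      with False show ?thesis by simp
    qed
  qed
  show "(\<lambda>i\<in>{..<k}. block n (?g Y) i) = Y" if Y: "Y \<in> {..<k} \<rightarrow>\<^sub>E cube n" for Y
  proof
    fix i
    show "(\<lambda>i\<in>{..<k}. block n (?g Y) i) i = Y i"
    proof (cases "i < k")
      case True
      then have Yi: "Y i \<in> cube n" using Y by auto
      have "block n (?g Y) i j = Y i j" for j
      proof (cases "j < n")
        case True
        then show ?thesis using lt[OF \<open>i < k\<close> True] by (simp add: block_def)
      next
        case False
        then show ?thesis using Yi by (auto simp: block_def cube_def PiE_def extensional_def)
      qed
      then show ?thesis using True by auto
    next
      case False
      then show ?thesis using Y by (auto simp: PiE_def extensional_def)
    qed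
  qed
qed

text \<open>The blocks of a uniform point are independent, so sums of products over blocks
  factorise. Joint laws, point counts and moment generating functions below are brought into this
  form.\<close>

lemma sum_prod_blocks:
  fixes \<phi> :: "nat \<Rightarrow> point \<Rightarrow> 'a::comm_semiring_1"
  shows "(\<Sum>X\<in>cube (k * n). \<Prod>i<k. \<phi> i (block n X i)) = (\<Prod>i<k. \<Sum>z\<in>cube n. \<phi> i z)"
proof -
  have "(\<Sum>X\<in>cube (k * n). \<Prod>i<k. \<phi> i (block n X i))
      = (\<Sum>X\<in>cube (k * n). \<Prod>i<k. \<phi> i ((\<lambda>i\<in>{..<k}. block n X i) i))"
    by (intro sum.cong prod.cong) auto
  also have "\<dots> = (\<Sum>Y\<in>{..<k} \<rightarrow>\<^sub>E cube n. \<Prod>i<k. \<phi> i (Y i))"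
    using sum.reindex_bij_betw[OF bij_betw_blocks, where g = "\<lambda>Y. \<Prod>i<k. \<phi> i (Y i)"] .
  also have "\<dots> = (\<Prod>i<k. \<Sum>z\<in>cube n. \<phi> i z)"
    by (subst prod_sum_PiE) auto
  finally show ?thesis .
qed

section \<open>The simple random walk: level sets and moments\<close>

lemma sum_cube_Suc:
  fixes \<phi> :: "int \<Rightarrow> 'a::comm_monoid_add"
  shows "(\<Sum>x\<in>cube (Suc k). \<phi> (\<Sum>i<Suc k. x i))
     = (\<Sum>x\<in>cube k. \<phi> ((\<Sum>i<k. x i) + 1)) + (\<Sum>x\<in>cube k. \<phi> ((\<Sum>i<k. x i) - 1))"
proof -
  have c: "cube (Suc k) = (\<lambda>(y, g). g(k := y)) ` ({-1, 1} \<times> cube k)"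
    unfolding cube_def lessThan_Suc by (rule PiE_insert_eq)
  have inj: "inj_on (\<lambda>(y, g). g(k := y)) ({-1, 1} \<times> cube k)"
    unfolding cube_def using inj_combinator[of k "{..<k}" "\<lambda>_. {-1, 1::int}"] by simp
  have "(\<Sum>x\<in>cube (Suc k). \<phi> (\<Sum>i<Suc k. x i))
      = (\<Sum>(y, g)\<in>{-1, 1::int} \<times> cube k. \<phi> ((\<Sum>i<k. g i) + y))"
    unfolding c by (subst sum.reindex[OF inj]) (auto intro!: sum.cong arg_cong[where f = \<phi>])
  also have "\<dots> = (\<Sum>y\<in>{-1, 1::int}. \<Sum>g\<in>cube k. \<phi> ((\<Sum>i<k. g i) + y))"
    by (rule sum.cartesian_product[symmetric])
  also have "\<dots> = (\<Sum>x\<in>cube k. \<phi> ((\<Sum>i<k. x i) + 1)) + (\<Sum>x\<in>cube k. \<phi> ((\<Sum>i<k. x i) - 1))"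
    by (simp add: add.commute)
  finally show ?thesis .
qed

lemma cube_0: "cube 0 = {\<lambda>_. undefined}"
  by (simp add: cube_def)

text \<open>A point with sum \<open>s\<close> has \<open>(s + k) / 2\<close> coordinates equal to 1,
  and splitting off the last coordinate is Pascal's rule. For the wrong parity the level set is
  empty. The guard for negative \<open>s + k\<close> keeps \<open>nat\<close> from truncating to 0
  and contributing a spurious 1 at the lower end of the recursion.\<close>

lemma card_sum_cube_le_binomial:
  "card {x \<in> cube k. (\<Sum>i<k. x i) = s}
     \<le> (if s + int k < 0 then 0 else k choose nat ((s + int k) div 2))"
proof (induction k arbitrary: s)
  case 0
  have "{x \<in> cube 0. (\<Sum>i<0. x i) = s} = (if s = 0 then cube 0 else {})" by auto
  then show ?case by auto
next
  case (Suc k)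
  have ind: "card {x \<in> cube d. P x} = (\<Sum>x\<in>cube d. if P x then 1 else 0)" for d P
    by (simp add: sum.If_cases Int_def)
  have rec: "card {x \<in> cube (Suc k). (\<Sum>i<Suc k. x i) = s}
      = card {x \<in> cube k. (\<Sum>i<k. x i) = s - 1} + card {x \<in> cube k. (\<Sum>i<k. x i) = s + 1}"
    unfolding ind using sum_cube_Suc[of "\<lambda>t. if t = s then 1 else (0::nat)" k]
    by (simp add: eq_diff_eq diff_eq_eq)
  define u where "u = (s + int (Suc k)) div 2"
  have b1: "card {x \<in> cube k. (\<Sum>i<k. x i) = s - 1} \<le> (if u < 1 then 0 else k choose nat (u - 1))"
  proof -
    have "(s - 1 + int k) div 2 = u - 1" by (simp add: u_def)
    moreover have "s - 1 + int k < 0 \<longleftrightarrow> u < 1" by (simp add: u_def) linarith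
    ultimately show ?thesis using Suc.IH[of "s - 1"] by presburger
  qed
  have b2: "card {x \<in> cube k. (\<Sum>i<k. x i) = s + 1} \<le> (if u < 0 then 0 else k choose nat u)"
  proof -
    have "(s + 1 + int k) div 2 = u" by (simp add: u_def algebra_simps)
    moreover have "s + 1 + int k < 0 \<longleftrightarrow> u < 0" unfolding u_def by linarith
    ultimately show ?thesis using Suc.IH[of "s + 1"] by presburger
  qed
  have u0: "s + int (Suc k) < 0 \<longleftrightarrow> u < 0" unfolding u_def by linarith
  have "(if u < 1 then 0 else k choose nat (u - 1)) + (if u < 0 then 0 else k choose nat u)
      \<le> (if u < 0 then 0 else Suc k choose nat u)"
  proof (cases "u < 1")
    case True
    then show ?thesis by (cases "u < 0") auto
  next
    case False
    then have "nat u = Suc (nat (u - 1))" by simp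
    then show ?thesis using False by simp
  qed
  from order_trans[OF add_mono[OF b1 b2] this] show ?case
    unfolding rec u0 by (simp only: u_def)
qed

lemma central_binomial_upper_bound:
  "real ((2 * m) choose m) * sqrt (real (2 * m + 1)) \<le> 4 ^ m"
proof -
  \<comment> \<open>The squared claim with the larger factor \<open>3 * m + 1\<close> is preserved
    by the recursion \<open>rec\<close> of the central coefficients; the step reduces to the
    inequality \<open>poly\<close>.\<close>
  have "real ((2 * m) choose m) ^ 2 * real (3 * m + 1) \<le> 16 ^ m"
  proof (induction m)
    case (Suc m)
    have rec: "real (Suc m) * real ((2 * Suc m) choose Suc m)
        = 2 * real (2 * m + 1) * real ((2 * m) choose m)"
    proof -
      have 1: "Suc m * ((2 * Suc m) choose Suc m) = (2 * Suc m) * ((2 * m + 1) choose m)"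
        using Suc_times_binomial_eq[of "2 * m + 1" m] by (simp add: mult.commute)
      have 2: "Suc m * ((2 * m + 1) choose Suc m) = (2 * m + 1) * ((2 * m) choose m)"
        using Suc_times_binomial_eq[of "2 * m" m] by (simp add: mult.commute)
      have 3: "(2 * m + 1) choose m = (2 * m + 1) choose Suc m"
        by (subst binomial_symmetric) auto
      have "Suc m * ((2 * Suc m) choose Suc m) = 2 * ((2 * m + 1) * ((2 * m) choose m))"
        unfolding 1 3 using 2 by (simp only: mult.assoc)
      then show ?thesis by (metis mult.assoc of_nat_mult of_nat_numeral)
    qed
    define c where "c = real ((2 * m) choose m)"
    define c' where "c' = real ((2 * Suc m) choose Suc m)"
    note rec = rec[folded c_def c'_def]
    have poly: "4 * real (2 * m + 1) ^ 2 * real (3 * m + 4) \<le> 16 * real (Suc m) ^ 2 * real (3 * m + 1)"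
      by (simp add: power2_eq_square algebra_simps)
    have "real (Suc m) ^ 2 * (c' ^ 2 * real (3 * Suc m + 1))
        = (real (Suc m) * c') ^ 2 * real (3 * m + 4)"
      by (simp add: power_mult_distrib)
    also have "\<dots> = c ^ 2 * (4 * real (2 * m + 1) ^ 2 * real (3 * m + 4))"
      unfolding rec by (simp add: power2_eq_square algebra_simps)
    also have "\<dots> \<le> c ^ 2 * (16 * real (Suc m) ^ 2 * real (3 * m + 1))"
      by (intro mult_left_mono poly) auto
    also have "\<dots> = real (Suc m) ^ 2 * (16 * (c ^ 2 * real (3 * m + 1)))" by simp
    also have "\<dots> \<le> real (Suc m) ^ 2 * (16 * 16 ^ m)"
    proof -
      have "c ^ 2 * real (3 * m + 1) \<le> 16 ^ m" unfolding c_def by (rule Suc.IH)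
      then have "16 * (c ^ 2 * real (3 * m + 1)) \<le> 16 * 16 ^ m" by (rule mult_left_mono) simp
      then show ?thesis by (rule mult_left_mono) simp
    qed
    finally have "c' ^ 2 * real (3 * Suc m + 1) \<le> 16 * 16 ^ m"
      by (rule mult_left_le_imp_le) simp
    then show ?case by (simp only: c'_def power_Suc)
  qed simp
  then have "real ((2 * m) choose m) ^ 2 * real (2 * m + 1) \<le> 16 ^ m"
    by (rule order_trans[rotated]) (intro mult_left_mono, auto)
  then have "(real ((2 * m) choose m) * sqrt (real (2 * m + 1))) ^ 2 \<le> (4 ^ m) ^ 2"
    by (simp add: power_mult_distrib power_commutes[symmetric] power_mult[symmetric] mult.commute[of m] power_mult[of _ 2])
  then show ?thesis by (rule power2_le_imp_le) simp
qed

text \<open>The middle coefficient of a row is the largest. In an odd row it is half of the central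
  coefficient of the next row.\<close>

lemma binomial_upper_bound: "real (k choose j) * sqrt (real k) \<le> 2 ^ k"
proof (cases "even k")
  case True
  then obtain m where k: "k = 2 * m" by auto
  have "real (k choose j) * sqrt (real k) \<le> real ((2 * m) choose m) * sqrt (real (2 * m + 1))"
    using binomial_maximum[of k j] by (intro mult_mono) (auto simp: k)
  also have "\<dots> \<le> 4 ^ m" by (rule central_binomial_upper_bound)
  finally show ?thesis by (simp add: k power_mult)
next
  case False
  then obtain m where k: "k = 2 * m + 1" by (auto elim: oddE)
  have half: "2 * ((2 * m + 1) choose m) = (2 * Suc m) choose Suc m"
  proof -
    have "(2 * Suc m) choose Suc m = ((2 * m + 1) choose m) + ((2 * m + 1) choose Suc m)"
      by simp
    moreover have "(2 * m + 1) choose m = (2 * m + 1) choose Suc m"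
      by (subst binomial_symmetric) auto
    ultimately show ?thesis by linarith
  qed
  have "2 * real ((2 * m + 1) choose m) = real ((2 * Suc m) choose Suc m)"
    using half by (metis of_nat_mult of_nat_numeral)
  then have "2 * (real (k choose j) * sqrt (real k))
      \<le> real ((2 * Suc m) choose Suc m) * sqrt (real (2 * Suc m + 1))"
    using binomial_maximum[of k j]
    by (simp only: mult.assoc[symmetric]) (intro mult_mono, auto simp: k)
  also have "\<dots> \<le> 4 ^ Suc m" by (rule central_binomial_upper_bound)
  finally show ?thesis by (simp add: k power_mult)
qed

text \<open>This is the small-ball estimate of the random walk. It later keeps the tally of a target
  away from 0 under a smooth distribution.\<close>

lemma card_sum_cube_le:
  "real (card {x \<in> cube k. (\<Sum>i<k. x i) = s}) * sqrt (real k) \<le> 2 ^ k"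
proof -
  have "card {x \<in> cube k. (\<Sum>i<k. x i) = s} \<le> k choose nat ((s + int k) div 2)"
    by (rule order_trans[OF card_sum_cube_le_binomial]) simp
  then have "real (card {x \<in> cube k. (\<Sum>i<k. x i) = s}) * sqrt (real k)
      \<le> real (k choose nat ((s + int k) div 2)) * sqrt (real k)"
    by (intro mult_right_mono) auto
  also have "\<dots> \<le> 2 ^ k" by (rule binomial_upper_bound)
  finally show ?thesis .
qed

text \<open>Both moments are proved in one induction, since
  \<open>(S + 1) ^ 4 + (S - 1) ^ 4 = 2 * S ^ 4 + 12 * S ^ 2 + 2\<close> brings the second moment
  into the recursion of the fourth.\<close>

lemma sum_cube_moments:
  fixes k :: nat
  defines "S \<equiv> (\<lambda>x :: point. real_of_int (\<Sum>i<k. x i))"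
  shows "(\<Sum>x\<in>cube k. S x ^ 2) = 2 ^ k * real k"
    and "(\<Sum>x\<in>cube k. S x ^ 4) = 2 ^ k * (3 * real k ^ 2 - 2 * real k)"
proof -
  have "(\<Sum>x\<in>cube k. real_of_int (\<Sum>i<k. x i) ^ 2) = 2 ^ k * real k \<and>
        (\<Sum>x\<in>cube k. real_of_int (\<Sum>i<k. x i) ^ 4) = 2 ^ k * (3 * real k ^ 2 - 2 * real k)"
  proof (induction k)
    case (Suc k)
    let ?S = "\<lambda>x :: point. real_of_int (\<Sum>i<k. x i)"
    have "(\<Sum>x\<in>cube (Suc k). real_of_int (\<Sum>i<Suc k. x i) ^ 2)
        = (\<Sum>x\<in>cube k. (?S x + 1) ^ 2 + (?S x - 1) ^ 2)"
      using sum_cube_Suc[of "\<lambda>t. real_of_int t ^ 2" k] by (simp add: sum.distrib)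
    also have "\<dots> = (\<Sum>x\<in>cube k. 2 * ?S x ^ 2 + 2)"
      by (intro sum.cong refl) (simp add: power2_eq_square algebra_simps)
    also have "\<dots> = 2 * (\<Sum>x\<in>cube k. ?S x ^ 2) + 2 * 2 ^ k"
      by (simp add: sum.distrib sum_distrib_left)
    finally have 2: "(\<Sum>x\<in>cube (Suc k). real_of_int (\<Sum>i<Suc k. x i) ^ 2) = 2 ^ Suc k * real (Suc k)"
      using Suc.IH by (simp add: algebra_simps)
    have "(\<Sum>x\<in>cube (Suc k). real_of_int (\<Sum>i<Suc k. x i) ^ 4)
        = (\<Sum>x\<in>cube k. (?S x + 1) ^ 4 + (?S x - 1) ^ 4)"
      using sum_cube_Suc[of "\<lambda>t. real_of_int t ^ 4" k] by (simp add: sum.distrib)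
    also have "\<dots> = (\<Sum>x\<in>cube k. 2 * ?S x ^ 4 + 12 * ?S x ^ 2 + 2)"
      by (intro sum.cong refl) (simp add: power4_eq_xxxx power2_eq_square algebra_simps)
    also have "\<dots> = 2 * (\<Sum>x\<in>cube k. ?S x ^ 4) + 12 * (\<Sum>x\<in>cube k. ?S x ^ 2) + 2 * 2 ^ k"
      by (simp add: sum.distrib sum_distrib_left)
    finally have "(\<Sum>x\<in>cube (Suc k). real_of_int (\<Sum>i<Suc k. x i) ^ 4)
        = 2 ^ Suc k * (3 * real (Suc k) ^ 2 - 2 * real (Suc k))"
      using Suc.IH by (simp add: power2_eq_square algebra_simps)
    with 2 show ?case by blast
  qed (simp add: cube_0)
  then show "(\<Sum>x\<in>cube k. S x ^ 2) = 2 ^ k * real k"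
    and "(\<Sum>x\<in>cube k. S x ^ 4) = 2 ^ k * (3 * real k ^ 2 - 2 * real k)"
    by (simp_all add: S_def)
qed

text \<open>The second and fourth moments bound the first one from below, since
  \<open>u \<ge> (3 u\<^sup>2 - u\<^sup>4) / 2\<close> for \<open>u \<ge> 0\<close>; this is used with \<open>u = \<bar>S\<bar> / (2 * sqrt k)\<close>.\<close>

lemma sum_cube_abs_ge:
  "(\<Sum>x\<in>cube k. \<bar>real_of_int (\<Sum>i<k. x i)\<bar>) \<ge> 2 ^ k * (sqrt (real k) / 2)"
proof (cases "k = 0")
  case False
  define S where "S = (\<lambda>x :: point. real_of_int (\<Sum>i<k. x i))"
  define l where "l = 2 * sqrt (real k)"
  have l: "l > 0" using False by (simp add: l_def)
  have l2: "l ^ 2 = 4 * real k" by (simp add: l_def power_mult_distrib)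
  have l3: "l ^ 3 = 4 * real k * l" using l2 by (simp add: power3_eq_cube power2_eq_square)
  have "3 / (2 * l) * S x ^ 2 - 1 / (2 * l ^ 3) * S x ^ 4 \<le> \<bar>S x\<bar>" for x
  proof -
    define u where "u = \<bar>S x\<bar> / l"
    have u: "u \<ge> 0" "\<bar>S x\<bar> = u * l" using l by (auto simp: u_def)
    \<comment> \<open>The quartic \<open>2 * u - 3 * u ^ 2 + u ^ 4\<close> has the roots 0 and -2
      and a double root at 1, so it is nonnegative for \<open>u \<ge> 0\<close>.\<close>
    have "0 \<le> u * ((u - 1) ^ 2 * (u + 2))" using u by simp
    also have "\<dots> = 2 * u - 3 * u ^ 2 + u ^ 4"
      by (simp add: power2_eq_square power4_eq_xxxx algebra_simps)
    finally have *: "3 / 2 * u ^ 2 - u ^ 4 / 2 \<le> u" by simp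
    have "S x ^ 2 = (u * l) ^ 2" "S x ^ 4 = (u * l) ^ 4"
      using u(2) by (metis power2_abs) (metis u(2) power_even_abs_numeral even_numeral)
    then have "3 / (2 * l) * S x ^ 2 - 1 / (2 * l ^ 3) * S x ^ 4 = (3 / 2 * u ^ 2 - u ^ 4 / 2) * l"
      using l by (simp add: field_simps power2_eq_square power4_eq_xxxx power3_eq_cube)
    also have "\<dots> \<le> u * l" using * l by (intro mult_right_mono) auto
    finally show ?thesis using u(2) by simp
  qed
  then have "(\<Sum>x\<in>cube k. 3 / (2 * l) * S x ^ 2 - 1 / (2 * l ^ 3) * S x ^ 4) \<le> (\<Sum>x\<in>cube k. \<bar>S x\<bar>)"
    by (intro sum_mono)
  moreover have "(\<Sum>x\<in>cube k. 3 / (2 * l) * S x ^ 2 - 1 / (2 * l ^ 3) * S x ^ 4)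
      = 3 / (2 * l) * (2 ^ k * real k) - 1 / (2 * l ^ 3) * (2 ^ k * (3 * real k ^ 2 - 2 * real k))"
    unfolding sum_subtractf sum_distrib_left[symmetric] S_def sum_cube_moments ..
  moreover have "3 / (2 * l) * (2 ^ k * real k) - 1 / (2 * l ^ 3) * (2 ^ k * (3 * real k ^ 2 - 2 * real k))
      = 2 ^ k * ((9 * real k + 2) / (8 * l))"
    unfolding l3 using l False by (simp add: field_simps power2_eq_square)
  moreover have "(9 * real k + 2) / (8 * l) \<ge> sqrt (real k) / 2"
  proof -
    have "sqrt (real k) * (8 * l) = 16 * real k" by (simp add: l_def)
    then show ?thesis using l by (simp add: field_simps)
  qed
  ultimately show ?thesis unfolding S_def
    by (smt (verit) mult_left_mono zero_le_power)
qed simp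

section \<open>Correlation of two lifted majorities\<close>

definition block_values :: "nat \<Rightarrow> nat \<Rightarrow> (nat \<Rightarrow> bfun) \<Rightarrow> point \<Rightarrow> point" where
  "block_values n k f X = (\<lambda>i\<in>{..<k}. f i (block n X i))"

definition lift_fun :: "nat \<Rightarrow> nat \<Rightarrow> bfun \<Rightarrow> (nat \<Rightarrow> bfun) \<Rightarrow> bfun" where
  "lift_fun n k g f = (\<lambda>X\<in>cube (k * n). g (block_values n k f X))"

definition correlation :: "nat \<Rightarrow> bfun \<Rightarrow> bfun \<Rightarrow> real" where
  "correlation n f g = (\<Sum>z\<in>cube n. real_of_int (f z * g z)) / 2 ^ n"

lemma Lift_eq: "Lift n k g = lift_fun n k g ` {f. \<forall>i<k. balanced n (f i)}"
  by (auto simp: Lift_def lift_fun_def block_values_def)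

lemma cube_cases: "x \<in> cube d \<Longrightarrow> i < d \<Longrightarrow> x i = -1 \<or> x i = 1"
  by (auto simp: cube_def)

lemma bool_fun_cases: "f \<in> bool_fun d \<Longrightarrow> x \<in> cube d \<Longrightarrow> f x = -1 \<or> f x = 1"
  by (auto simp: bool_fun_def)

lemma balanced_bool_fun: "balanced n f \<Longrightarrow> f \<in> bool_fun n"
  by (simp add: balanced_def)

lemma cube_eqI:
  assumes "x \<in> cube d" "y \<in> cube d" "\<And>i. i < d \<Longrightarrow> x i = y i"
  shows "x = y"
  using assms unfolding cube_def by (intro PiE_ext) auto

lemma block_values_in_cube:
  assumes "X \<in> cube (k * n)" "\<And>i. i < k \<Longrightarrow> f i \<in> bool_fun n"
  shows "block_values n k f X \<in> cube k"
  using bool_fun_cases[OF assms(2) block_in_cube[OF assms(1)]]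
  by (fastforce simp: block_values_def cube_def)

lemma lift_fun_bool_fun:
  assumes "g \<in> bool_fun k" "\<And>i. i < k \<Longrightarrow> f i \<in> bool_fun n"
  shows "lift_fun n k g f \<in> bool_fun (k * n)"
  using bool_fun_cases[OF assms(1) block_values_in_cube[OF _ assms(2)]]
  by (fastforce simp: lift_fun_def bool_fun_def)

lemma majority_bool_fun: "majority k \<in> bool_fun k"
  by (auto simp: majority_def bool_fun_def sign_pm_def)

lemma sum_balanced:
  assumes "balanced n f"
  shows "(\<Sum>z\<in>cube n. f z) = 0"
proof -
  have "(\<Sum>z\<in>cube n. f z)
      = (\<Sum>z\<in>cube n. (if f z = 1 then 1 else 0) - (if f z = -1 then 1 else 0))"
    using bool_fun_cases[OF balanced_bool_fun[OF assms]] by (intro sum.cong) fastforce+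
  also have "\<dots> = int (card {x \<in> cube n. f x = 1}) - int (card {x \<in> cube n. f x = -1})"
    by (simp add: sum_subtractf sum.If_cases Int_def)
  finally show ?thesis using assms by (simp add: balanced_def)
qed

text \<open>Each factor is 1 or 0 according to whether the coordinates agree. This writes a point
  indicator as a product over coordinates, the form that \<open>sum_prod_blocks\<close> can
  handle.\<close>

lemma prod_cube_delta:
  assumes "x \<in> cube k" "v \<in> cube k"
  shows "(\<Prod>i<k. (1 + real_of_int (x i) * real_of_int (v i)) / 2) = (if x = v then 1 else 0)"
proof (cases "x = v")
  case True
  then have "(1 + real_of_int (x i) * real_of_int (v i)) / 2 = 1" if "i < k" for i
    using cube_cases[OF assms(1) that] by auto
  then show ?thesis using True by simp
next
  case False
  then obtain i where i: "i < k" "x i \<noteq> v i" using cube_eqI[OF assms] by blast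
  then have "(1 + real_of_int (x i) * real_of_int (v i)) / 2 = 0"
    using cube_cases[OF assms(1), of i] cube_cases[OF assms(2), of i] by auto
  then have "(\<Prod>i<k. (1 + real_of_int (x i) * real_of_int (v i)) / 2) = 0"
    using i(1) by (intro prod_zero) auto
  then show ?thesis using False by simp
qed

text \<open>For balanced \<open>f i\<close> and \<open>f' i\<close> with correlation
  \<open>\<rho>\<close>, their values on a uniform block are \<open>x\<close> and \<open>y\<close>
  with probability \<open>(1 + \<rho> * x * y) / 4\<close>, and the blocks are independent. Hence
  the joint law of the two value vectors depends on the targets only through the
  correlations.\<close>

lemma sum_pair_block_values:
  assumes "\<And>i. i < k \<Longrightarrow> balanced n (f i)" "\<And>i. i < k \<Longrightarrow> balanced n (f' i)"
  shows "(\<Sum>X\<in>cube (k * n). \<Phi> (block_values n k f X) (block_values n k f' X))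
    = 2 ^ (k * n) / 4 ^ k * (\<Sum>x\<in>cube k. \<Sum>y\<in>cube k. \<Phi> x y *
        (\<Prod>i<k. 1 + correlation n (f i) (f' i) * (real_of_int (x i) * real_of_int (y i))))"
proof -
  let ?v = "block_values n k f" and ?v' = "block_values n k f'"
  let ?d = "\<lambda>x v :: point. \<Prod>i<k. (1 + real_of_int (x i) * real_of_int (v i)) / 2"
  have v: "?v X \<in> cube k" "?v' X \<in> cube k" if "X \<in> cube (k * n)" for X
    using that assms by (auto intro!: block_values_in_cube balanced_bool_fun)
  \<comment> \<open>\<open>\<Phi>\<close> is expanded in point indicators, so that the sum over
    \<open>X\<close> meets only products over the blocks.\<close>
  have expand: "\<Phi> (?v X) (?v' X) = (\<Sum>x\<in>cube k. \<Sum>y\<in>cube k. \<Phi> x y * (?d x (?v X) * ?d y (?v' X)))"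
    if "X \<in> cube (k * n)" for X
  proof -
    have "(\<Sum>x\<in>cube k. \<Sum>y\<in>cube k. \<Phi> x y * (?d x (?v X) * ?d y (?v' X)))
        = (\<Sum>x\<in>cube k. \<Sum>y\<in>cube k. if y = ?v' X then (if x = ?v X then \<Phi> x y else 0) else 0)"
      using v[OF that] by (intro sum.cong refl) (simp add: prod_cube_delta)
    also have "\<dots> = \<Phi> (?v X) (?v' X)"
      using v[OF that] by (simp add: sum.delta)
    finally show ?thesis by simp
  qed
  have marginal: "(\<Sum>z\<in>cube n. (1 + real_of_int (x i) * real_of_int (f i z)) / 2
        * ((1 + real_of_int (y i) * real_of_int (f' i z)) / 2))
      = 2 ^ n / 4 * (1 + correlation n (f i) (f' i) * (real_of_int (x i) * real_of_int (y i)))"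
    if "i < k" for i and x y :: point
  proof -
    have s: "(\<Sum>z\<in>cube n. real_of_int (f i z)) = 0" "(\<Sum>z\<in>cube n. real_of_int (f' i z)) = 0"
      using sum_balanced[OF assms(1)[OF that]] sum_balanced[OF assms(2)[OF that]]
      by (simp_all flip: of_int_sum)
    have c: "(\<Sum>z\<in>cube n. real_of_int (f i z) * real_of_int (f' i z)) = 2 ^ n * correlation n (f i) (f' i)"
      by (simp add: correlation_def)
    have "(\<Sum>z\<in>cube n. (1 + real_of_int (x i) * real_of_int (f i z)) / 2
        * ((1 + real_of_int (y i) * real_of_int (f' i z)) / 2))
      = (\<Sum>z\<in>cube n. 1 / 4 + real_of_int (x i) / 4 * real_of_int (f i z)
         + real_of_int (y i) / 4 * real_of_int (f' i z)
         + real_of_int (x i) * real_of_int (y i) / 4 * (real_of_int (f i z) * real_of_int (f' i z)))"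
      by (intro sum.cong refl) (simp add: field_simps)
    \<comment> \<open>The two linear terms vanish because both functions are balanced.\<close>
    also have "\<dots> = 2 ^ n / 4 + real_of_int (x i) * real_of_int (y i) / 4 * (2 ^ n * correlation n (f i) (f' i))"
      by (simp only: sum.distrib sum_distrib_left[symmetric] s c) simp
    finally show ?thesis by (simp add: algebra_simps)
  qed
  have "(\<Sum>X\<in>cube (k * n). \<Phi> (?v X) (?v' X))
      = (\<Sum>X\<in>cube (k * n). \<Sum>x\<in>cube k. \<Sum>y\<in>cube k. \<Phi> x y * (?d x (?v X) * ?d y (?v' X)))"
    by (intro sum.cong refl expand)
  also have "\<dots> = (\<Sum>x\<in>cube k. \<Sum>y\<in>cube k. \<Phi> x y * (\<Sum>X\<in>cube (k * n). ?d x (?v X) * ?d y (?v' X)))"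
    unfolding sum_distrib_left by (rule trans[OF sum.swap]) (intro sum.cong refl sum.swap)
  also have "\<dots> = (\<Sum>x\<in>cube k. \<Sum>y\<in>cube k. \<Phi> x y * (2 ^ (k * n) / 4 ^ k *
        (\<Prod>i<k. 1 + correlation n (f i) (f' i) * (real_of_int (x i) * real_of_int (y i)))))"
  proof (intro sum.cong refl arg_cong2[where f = "(*)"])
    fix x y
    have "(\<Sum>X\<in>cube (k * n). ?d x (?v X) * ?d y (?v' X))
        = (\<Sum>X\<in>cube (k * n). \<Prod>i<k. (1 + real_of_int (x i) * real_of_int (f i (block n X i))) / 2
            * ((1 + real_of_int (y i) * real_of_int (f' i (block n X i))) / 2))"
      unfolding prod.distrib[symmetric] by (intro sum.cong prod.cong refl) (simp add: block_values_def)
    also have "\<dots> = (\<Prod>i<k. \<Sum>z\<in>cube n. (1 + real_of_int (x i) * real_of_int (f i z)) / 2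
            * ((1 + real_of_int (y i) * real_of_int (f' i z)) / 2))"
      by (rule sum_prod_blocks)
    also have "\<dots> = (\<Prod>i<k. 2 ^ n / 4 * (1 + correlation n (f i) (f' i) * (real_of_int (x i) * real_of_int (y i))))"
      by (intro prod.cong refl marginal) simp
    also have "\<dots> = 2 ^ (k * n) / 4 ^ k *
        (\<Prod>i<k. 1 + correlation n (f i) (f' i) * (real_of_int (x i) * real_of_int (y i)))"
      unfolding prod.distrib by (simp add: power_divide mult.commute[of k] flip: power_mult)
    finally show "(\<Sum>X\<in>cube (k * n). ?d x (?v X) * ?d y (?v' X)) = \<dots>" .
  qed
  also have "\<dots> = 2 ^ (k * n) / 4 ^ k * (\<Sum>x\<in>cube k. \<Sum>y\<in>cube k. \<Phi> x y *
        (\<Prod>i<k. 1 + correlation n (f i) (f' i) * (real_of_int (x i) * real_of_int (y i))))"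
    by (simp add: sum_distrib_left mult_ac)
  finally show ?thesis .
qed

section \<open>Fourier expansion of the noise kernel\<close>

definition fourier :: "nat \<Rightarrow> (point \<Rightarrow> real) \<Rightarrow> nat set \<Rightarrow> real" where
  "fourier k g A = (\<Sum>x\<in>cube k. g x * (\<Prod>i\<in>A. real_of_int (x i)))"

text \<open>Expanding the product over the subsets \<open>A\<close> splits the kernel into terms
  that separate \<open>x\<close> from \<open>y\<close>, so each double sum becomes a square.\<close>

lemma noise_kernel_fourier:
  "(\<Sum>x\<in>cube k. \<Sum>y\<in>cube k. g x * g y * (\<Prod>i<k. 1 + \<rho> i * (real_of_int (x i) * real_of_int (y i))))
     = (\<Sum>A\<in>Pow {..<k}. (\<Prod>i\<in>A. \<rho> i) * fourier k g A ^ 2)"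
proof -
  let ?x = "\<lambda>A x :: point. \<Prod>i\<in>A. real_of_int (x i)"
  have kernel: "(\<Prod>i<k. 1 + \<rho> i * (real_of_int (x i) * real_of_int (y i)))
      = (\<Sum>A\<in>Pow {..<k}. (\<Prod>i\<in>A. \<rho> i) * (?x A x * ?x A y))" for x y :: point
  proof -
    have "(\<Prod>i<k. \<rho> i * (real_of_int (x i) * real_of_int (y i)) + 1)
        = (\<Sum>A\<in>Pow {..<k}. (\<Prod>i\<in>A. \<rho> i * (real_of_int (x i) * real_of_int (y i))) * (\<Prod>i\<in>{..<k} - A. 1))"
      by (rule prod_add) simp
    then show ?thesis by (simp add: prod.distrib add.commute)
  qed
  have "(\<Sum>x\<in>cube k. \<Sum>y\<in>cube k. g x * g y * (\<Prod>i<k. 1 + \<rho> i * (real_of_int (x i) * real_of_int (y i))))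
      = (\<Sum>x\<in>cube k. \<Sum>y\<in>cube k. \<Sum>A\<in>Pow {..<k}. (\<Prod>i\<in>A. \<rho> i) * ((g x * ?x A x) * (g y * ?x A y)))"
    unfolding kernel sum_distrib_left by (intro sum.cong refl) (simp only: mult_ac)
  also have "\<dots> = (\<Sum>A\<in>Pow {..<k}. \<Sum>x\<in>cube k. \<Sum>y\<in>cube k. (\<Prod>i\<in>A. \<rho> i) * ((g x * ?x A x) * (g y * ?x A y)))"
    by (subst sum.swap, subst (2) sum.swap, subst sum.swap) (intro sum.cong refl sum.swap)
  also have "\<dots> = (\<Sum>A\<in>Pow {..<k}. (\<Prod>i\<in>A. \<rho> i) * fourier k g A ^ 2)"
    by (intro sum.cong refl) (simp add: fourier_def power2_eq_square sum_product flip: sum_distrib_left)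
  finally show ?thesis .
qed

text \<open>With all \<open>\<rho> i = 1\<close> the kernel is \<open>2 ^ k\<close> times the
  identity matrix. The coefficients \<open>fourier\<close> are not normalised by
  \<open>2 ^ k\<close>, whence the value \<open>4 ^ k\<close>.\<close>

lemma parseval:
  assumes "\<And>x. x \<in> cube k \<Longrightarrow> g x ^ 2 = 1"
  shows "(\<Sum>A\<in>Pow {..<k}. fourier k g A ^ 2) = 4 ^ k"
proof -
  have "(\<Sum>A\<in>Pow {..<k}. fourier k g A ^ 2)
      = (\<Sum>x\<in>cube k. \<Sum>y\<in>cube k. g x * g y * (\<Prod>i<k. 1 + 1 * (real_of_int (x i) * real_of_int (y i))))"
    unfolding noise_kernel_fourier by simp
  also have "\<dots> = (\<Sum>x\<in>cube k. \<Sum>y\<in>cube k. g x * g y * (2 ^ k * (if x = y then 1 else 0)))"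
  proof (intro sum.cong refl arg_cong2[where f = "(*)"])
    fix x y assume "x \<in> cube k" "y \<in> cube k"
    then show "(\<Prod>i<k. 1 + 1 * (real_of_int (x i) * real_of_int (y i))) = 2 ^ k * (if x = y then 1 else 0)"
      using prod_cube_delta[of x k y] by (simp add: prod_dividef split: if_splits)
  qed
  also have "\<dots> = (\<Sum>x\<in>cube k. \<Sum>y\<in>cube k. if y = x then 2 ^ k * g x ^ 2 else 0)"
    by (intro sum.cong refl) (simp add: power2_eq_square)
  also have "\<dots> = (\<Sum>x\<in>cube k. 2 ^ k)"
    using assms by (simp add: sum.delta)
  also have "\<dots> = 4 ^ k" by (simp flip: power_mult_distrib)
  finally show ?thesis .
qed

text \<open>By \<open>parseval\<close> the deficit from \<open>4 ^ k\<close> is the sum over all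
  \<open>A\<close> of \<open>fourier k g A ^ 2\<close> weighted by one minus the product of the
  \<open>\<rho> i\<close>. All terms are nonnegative and only the singletons are kept.\<close>

lemma noise_kernel_le:
  assumes "\<And>x. x \<in> cube k \<Longrightarrow> g x ^ 2 = 1" and \<rho>: "\<And>i. i < k \<Longrightarrow> \<bar>\<rho> i\<bar> \<le> 1"
  shows "(\<Sum>x\<in>cube k. \<Sum>y\<in>cube k. g x * g y * (\<Prod>i<k. 1 + \<rho> i * (real_of_int (x i) * real_of_int (y i))))
     \<le> 4 ^ k - (\<Sum>i<k. (1 - \<rho> i) * fourier k g {i} ^ 2)"
proof -
  have "(\<Sum>i<k. (1 - \<rho> i) * fourier k g {i} ^ 2)
      = (\<Sum>A\<in>(\<lambda>i. {i}) ` {..<k}. (1 - (\<Prod>i\<in>A. \<rho> i)) * fourier k g A ^ 2)"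
    by (subst sum.reindex) (auto simp: inj_on_def)
  also have "\<dots> \<le> (\<Sum>A\<in>Pow {..<k}. (1 - (\<Prod>i\<in>A. \<rho> i)) * fourier k g A ^ 2)"
  proof (rule sum_mono2)
    fix A assume "A \<in> Pow {..<k} - (\<lambda>i. {i}) ` {..<k}"
    then have "\<bar>\<Prod>i\<in>A. \<rho> i\<bar> \<le> 1"
      unfolding abs_prod using \<rho> by (intro prod_le_1) auto
    then show "0 \<le> (1 - (\<Prod>i\<in>A. \<rho> i)) * fourier k g A ^ 2" by simp
  qed auto
  also have "\<dots> = 4 ^ k - (\<Sum>A\<in>Pow {..<k}. (\<Prod>i\<in>A. \<rho> i) * fourier k g A ^ 2)"
    using parseval[OF assms(1)] by (simp add: left_diff_distrib sum_subtractf)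
  finally show ?thesis unfolding noise_kernel_fourier by simp
qed

text \<open>By symmetry all singleton coefficients are equal, and they add up to the sum of
  \<open>\<bar>S\<bar>\<close> over the cube, \<open>S\<close> being the coordinate sum. So each one
  is at least \<open>2 ^ k / (2 * sqrt k)\<close>.\<close>

lemma fourier_majority_singleton:
  assumes "i < k"
  shows "fourier k (\<lambda>x. real_of_int (majority k x)) {i} ^ 2 \<ge> 4 ^ k / (4 * real k)"
proof -
  let ?w = "\<lambda>i. \<Sum>x\<in>cube k. majority k x * x i"
  \<comment> \<open>Transposing the coordinates \<open>i\<close> and \<open>j\<close> permutes the
    cube and preserves the coordinate sum, hence majority.\<close>
  have sym: "?w j = ?w i" if "j < k" for j
  proof -
    let ?t = "Transposition.transpose i j"
    let ?p = "\<lambda>x :: point. x \<circ> ?t"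
    have t: "?t l < k \<longleftrightarrow> l < k" for l using assms that by (simp add: Transposition.transpose_def)
    have p: "?p x \<in> cube k" if "x \<in> cube k" for x
      using that t unfolding cube_def by (auto simp: PiE_iff extensional_def)
    have bij: "bij_betw ?p (cube k) (cube k)"
      by (rule bij_betwI[where g = ?p]) (use p in \<open>auto simp: comp_assoc\<close>)
    have s: "(\<Sum>l<k. ?p x l) = (\<Sum>l<k. x l)" for x
    proof -
      have "bij_betw ?t {..<k} {..<k}"
        by (rule bij_betwI[where g = ?t]) (use t in auto)
      then show ?thesis using sum.reindex_bij_betw[of ?t "{..<k}" "{..<k}" x] by simp
    qed
    have "?w i = (\<Sum>x\<in>cube k. majority k (?p x) * ?p x i)"
      using sum.reindex_bij_betw[OF bij, of "\<lambda>x. majority k x * x i"] by simp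
    also have "\<dots> = ?w j"
      by (intro sum.cong refl) (use p s in \<open>simp add: majority_def\<close>)
    finally show ?thesis by simp
  qed
  have "real k * real_of_int (?w i) = (\<Sum>j<k. real_of_int (?w j))"
    using sym by simp
  also have "\<dots> = real_of_int (\<Sum>x\<in>cube k. \<Sum>j<k. majority k x * x j)"
    by (subst sum.swap) simp
  \<comment> \<open>Majority times the coordinate sum is the absolute value of the sum; on ties both
    are 0.\<close>
  also have "\<dots> = (\<Sum>x\<in>cube k. \<bar>real_of_int (\<Sum>i<k. x i)\<bar>)"
    unfolding of_int_sum[of _ "cube k"]
    by (intro sum.cong refl, simp only: sum_distrib_left[symmetric])
      (simp add: majority_def sign_pm_def del: of_int_sum)
  also have "\<dots> \<ge> 2 ^ k * (sqrt (real k) / 2)" by (rule sum_cube_abs_ge)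
  finally have w: "2 ^ k * (sqrt (real k) / 2) \<le> real k * real_of_int (?w i)" .
  have "real k * (4 ^ k / 4) = (2 ^ k * (sqrt (real k) / 2)) ^ 2"
    using power_mult_distrib[of 2 "2::real" k]
    by (simp add: power_mult_distrib power_divide power2_eq_square[of "2 ^ k"])
  also have "\<dots> \<le> (real k * real_of_int (?w i)) ^ 2"
    by (rule power_mono[OF w]) simp
  also have "\<dots> = real k * (real k * real_of_int (?w i) ^ 2)"
    by (simp add: power2_eq_square mult_ac)
  finally have "real k * (4 ^ k / 4) \<le> real k * (real k * real_of_int (?w i) ^ 2)" .
  then have "4 ^ k / 4 \<le> real k * real_of_int (?w i) ^ 2"
    using assms by (simp only: mult_le_cancel_left_pos of_nat_0_less_iff)
  then have "4 ^ k / (4 * real k) \<le> real_of_int (?w i) ^ 2"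
    using assms by (simp add: field_simps)
  then show ?thesis by (simp add: fourier_def)
qed

lemma correlation_bool_fun:
  assumes "f \<in> bool_fun n" "g \<in> bool_fun n"
  shows "1 - correlation n f g = 2 * real (card {z \<in> cube n. f z \<noteq> g z}) / 2 ^ n"
    and "\<bar>correlation n f g\<bar> \<le> 1"
proof -
  have "(\<Sum>z\<in>cube n. real_of_int (f z * g z)) = (\<Sum>z\<in>cube n. 1 - 2 * (if f z \<noteq> g z then 1 else 0))"
    using bool_fun_cases[OF assms(1)] bool_fun_cases[OF assms(2)]
    by (intro sum.cong refl) fastforce
  also have "\<dots> = 2 ^ n - 2 * real (card {z \<in> cube n. f z \<noteq> g z})"
    by (simp add: sum_subtractf sum.If_cases Int_def flip: sum_distrib_left)
  finally have s: "(\<Sum>z\<in>cube n. real_of_int (f z * g z)) = \<dots>" .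
  show e: "1 - correlation n f g = 2 * real (card {z \<in> cube n. f z \<noteq> g z}) / 2 ^ n"
    unfolding correlation_def s by (simp add: field_simps)
  have "card {z \<in> cube n. f z \<noteq> g z} \<le> card (cube n)" by (intro card_mono) auto
  then have "real (card {z \<in> cube n. f z \<noteq> g z}) \<le> 2 ^ n" by (simp flip: of_nat_le_iff)
  then have "0 \<le> 1 - correlation n f g" "1 - correlation n f g \<le> 2"
    unfolding e by (auto simp: field_simps)
  then show "\<bar>correlation n f g\<bar> \<le> 1" by linarith
qed

text \<open>Each singleton carries at least the fraction \<open>1 / (4 * k)\<close> of the Fourier
  weight, which turns the deficits \<open>1 - \<rho>\<close> of the blocks into a deficit of the
  majorities.\<close>

lemma sum_lift_majority_le:
  assumes k: "k \<ge> 1" and f: "\<And>i. i < k \<Longrightarrow> balanced n (f i)" and f': "\<And>i. i < k \<Longrightarrow> balanced n (f' i)"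
  shows "(\<Sum>X\<in>cube (k * n). real_of_int (lift_fun n k (majority k) f X * lift_fun n k (majority k) f' X))
    \<le> 2 ^ (k * n) * (1 - (\<Sum>i<k. 1 - correlation n (f i) (f' i)) / (4 * real k))"
proof -
  let ?g = "\<lambda>x. real_of_int (majority k x)"
  let ?\<rho> = "\<lambda>i. correlation n (f i) (f' i)"
  have \<rho>: "\<bar>?\<rho> i\<bar> \<le> 1" if "i < k" for i
    using f f' that by (intro correlation_bool_fun balanced_bool_fun) auto
  have g: "?g x ^ 2 = 1" if "x \<in> cube k" for x
    using bool_fun_cases[OF majority_bool_fun that] by auto
  have "(\<Sum>X\<in>cube (k * n). real_of_int (lift_fun n k (majority k) f X * lift_fun n k (majority k) f' X))
      = (\<Sum>X\<in>cube (k * n). ?g (block_values n k f X) * ?g (block_values n k f' X))"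
    by (intro sum.cong refl) (simp add: lift_fun_def)
  also have "\<dots> = 2 ^ (k * n) / 4 ^ k * (\<Sum>x\<in>cube k. \<Sum>y\<in>cube k. ?g x * ?g y *
        (\<Prod>i<k. 1 + ?\<rho> i * (real_of_int (x i) * real_of_int (y i))))"
    using f f' by (rule sum_pair_block_values)
  also have "\<dots> \<le> 2 ^ (k * n) / 4 ^ k * (4 ^ k - (\<Sum>i<k. (1 - ?\<rho> i) * fourier k ?g {i} ^ 2))"
    using g \<rho> by (intro mult_left_mono noise_kernel_le) auto
  also have "\<dots> \<le> 2 ^ (k * n) / 4 ^ k * (4 ^ k - (\<Sum>i<k. (1 - ?\<rho> i) * (4 ^ k / (4 * real k))))"
    using \<rho> by (intro mult_left_mono diff_mono sum_mono fourier_majority_singleton) (auto simp: abs_le_iff)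
  also have "\<dots> = 2 ^ (k * n) * (1 - (\<Sum>i<k. 1 - ?\<rho> i) / (4 * real k))"
    by (simp only: sum_distrib_right[symmetric]) (simp add: field_simps)
  finally show ?thesis .
qed

section \<open>The sample lower bound\<close>

lemma measure_pmf_bind_finite:
  fixes p :: "'a pmf" and f :: "'a \<Rightarrow> 'b pmf"
  assumes "finite A" "set_pmf p \<subseteq> A" "\<And>x. x \<in> A \<Longrightarrow> finite (set_pmf (f x))"
  shows "measure_pmf.prob (bind_pmf p f) B = (\<Sum>x\<in>A. pmf p x * measure_pmf.prob (f x) B)"
  using pmf_expectation_bind[OF assms(1,3,2), where h = "indicator B :: 'b \<Rightarrow> real"] by simp

lemma finite_bool_fun [simp]: "finite (bool_fun d)"
  by (simp add: bool_fun_def finite_PiE)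

lemma finite_lists_of_length: "finite A \<Longrightarrow> finite {xs \<in> lists A. length xs = m}"
  using finite_lists_length_eq[of A m] by (simp add: lists_eq_set)

text \<open>On a fixed sample of points, the learner sees one of at most \<open>2 ^ m\<close> label
  vectors, and each hypothesis that it may output serves at most \<open>L\<close> targets.\<close>

lemma learner_counting:
  fixes F :: "'i \<Rightarrow> bfun" and G :: "'i \<Rightarrow> bfun set"
  assumes I: "finite I" and A: "is_learner d A" and D: "set_pmf D \<subseteq> cube d"
    and F: "\<And>i. i \<in> I \<Longrightarrow> F i \<in> bool_fun d"
    and L: "\<And>h. h \<in> bool_fun d \<Longrightarrow> real (card {i \<in> I. h \<in> G i}) \<le> L"
    and p: "\<And>i. i \<in> I \<Longrightarrow> measure_pmf.prob (output_pmf A m D (F i)) (G i) \<ge> p"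
  shows "real (card I) * p \<le> 2 ^ m * L"
proof -
  define XS where "XS = {xs \<in> lists (cube d). length xs = m}"
  define YS where "YS = {ys \<in> lists {-1, 1 :: int}. length ys = m}"
  let ?q = "pmf (replicate_pmf m D)"
  have fin: "finite XS" "finite YS"
    by (simp_all add: XS_def YS_def finite_lists_of_length)
  have sup: "set_pmf (replicate_pmf m D) \<subseteq> XS"
    using D by (auto simp: XS_def set_replicate_pmf)
  have A': "set_pmf (A S) \<subseteq> bool_fun d" for S
    using A by (simp add: is_learner_def)
  have A'': "finite (set_pmf (A S))" for S
    by (rule finite_subset[OF A' finite_bool_fun])
  have L0: "L \<ge> 0"
    using L[of "\<lambda>x\<in>cube d. 1"] by (auto simp: bool_fun_def intro: order_trans[rotated])
  have cardYS: "card YS = 2 ^ m"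
    using card_lists_length_eq[of "{-1, 1::int}" m] by (simp add: YS_def lists_eq_set numeral_2_eq_2)
  have prob_sum: "measure_pmf.prob (A S) B = (\<Sum>h\<in>bool_fun d. pmf (A S) h * indicator B h)" for S B
    using integral_measure_pmf_real[of "bool_fun d" "A S" "indicator B :: _ \<Rightarrow> real"] A'[of S]
    by (auto simp: mult.commute)
  have hyp: "(\<Sum>i\<in>I. measure_pmf.prob (A S) (G i)) \<le> L" for S
  proof -
    have "(\<Sum>i\<in>I. measure_pmf.prob (A S) (G i))
        = (\<Sum>h\<in>bool_fun d. pmf (A S) h * (\<Sum>i\<in>I. indicator (G i) h))"
      unfolding prob_sum sum_distrib_left by (rule sum.swap)
    also have "\<dots> = (\<Sum>h\<in>bool_fun d. pmf (A S) h * real (card {i \<in> I. h \<in> G i}))"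
      using I by (simp add: indicator_def sum.If_cases Int_def)
    also have "\<dots> \<le> (\<Sum>h\<in>bool_fun d. pmf (A S) h * L)"
      using L by (intro sum_mono mult_left_mono) auto
    also have "\<dots> = L"
      using sum_pmf_eq_1[OF finite_bool_fun A'] by (simp flip: sum_distrib_right)
    finally show ?thesis .
  qed
  \<comment> \<open>Passing to all label vectors removes the dependence on the target, so that for a
    fixed labelled sample the sum over \<open>i\<close> is bounded by \<open>hyp\<close>.\<close>
  have label: "measure_pmf.prob (A (map (\<lambda>x. (x, F i x)) xs)) B
      \<le> (\<Sum>ys\<in>YS. measure_pmf.prob (A (zip xs ys)) B)" if "xs \<in> XS" "i \<in> I" for xs i B
  proof -
    have "map (F i) xs \<in> YS"
      using bool_fun_cases[OF F[OF that(2)]] that(1) by (fastforce simp: XS_def YS_def)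
    moreover have "map (\<lambda>x. (x, F i x)) xs = zip xs (map (F i) xs)"
      by (simp add: zip_map2 zip_same_conv_map)
    ultimately show ?thesis
      using fin(2) by (simp add: member_le_sum[where f = "\<lambda>ys. measure_pmf.prob (A (zip xs ys)) B"])
  qed
  have "real (card I) * p = (\<Sum>i\<in>I. p)" by simp
  also have "\<dots> \<le> (\<Sum>i\<in>I. measure_pmf.prob (output_pmf A m D (F i)) (G i))"
    by (intro sum_mono p)
  also have "\<dots> = (\<Sum>i\<in>I. \<Sum>xs\<in>XS. ?q xs * measure_pmf.prob (A (map (\<lambda>x. (x, F i x)) xs)) (G i))"
    unfolding output_pmf_def using fin(1) sup A'' by (subst measure_pmf_bind_finite[of XS]) auto
  also have "\<dots> \<le> (\<Sum>i\<in>I. \<Sum>xs\<in>XS. ?q xs * (\<Sum>ys\<in>YS. measure_pmf.prob (A (zip xs ys)) (G i)))"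
    by (intro sum_mono mult_left_mono label) auto
  also have "\<dots> = (\<Sum>xs\<in>XS. ?q xs * (\<Sum>ys\<in>YS. \<Sum>i\<in>I. measure_pmf.prob (A (zip xs ys)) (G i)))"
    by (subst sum.swap) (simp only: sum_distrib_left[symmetric] sum.swap[of _ YS])
  also have "\<dots> \<le> (\<Sum>xs\<in>XS. ?q xs * (\<Sum>ys\<in>YS. L))"
    by (intro sum_mono mult_left_mono hyp) auto
  also have "\<dots> = 2 ^ m * L"
    using sum_pmf_eq_1[OF fin(1) sup] by (simp add: cardYS flip: sum_distrib_right)
  finally show ?thesis .
qed

section \<open>Counting balanced functions and close tuples\<close>

lemma card_balanced_ge:
  assumes "n \<ge> 1"
  shows "real (card {f. balanced n f}) \<ge> 2 ^ (2 ^ n) / 2 ^ n"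
proof -
  define m :: nat where "m = 2 ^ (n - 1)"
  have m: "2 * m = 2 ^ n" "m > 0" using assms by (auto simp: m_def simp flip: power_Suc)
  \<comment> \<open>\<open>?h\<close> sends a set of half the points to a balanced function; the
    number of such sets is a central binomial coefficient.\<close>
  let ?h = "\<lambda>A :: point set. \<lambda>z\<in>cube n. if z \<in> A then 1 else -1 :: int"
  have inj: "inj_on ?h {A. A \<subseteq> cube n \<and> card A = m}"
  proof (rule inj_onI)
    fix A B assume "A \<in> {A. A \<subseteq> cube n \<and> card A = m}" "B \<in> {A. A \<subseteq> cube n \<and> card A = m}"
      and eq: "?h A = ?h B"
    then have "A \<subseteq> cube n" "B \<subseteq> cube n" by auto
    moreover have "z \<in> A \<longleftrightarrow> z \<in> B" if "z \<in> cube n" for z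
      using fun_cong[OF eq, of z] that by (auto split: if_splits)
    ultimately show "A = B" by blast
  qed
  have sub: "?h ` {A. A \<subseteq> cube n \<and> card A = m} \<subseteq> {f. balanced n f}"
  proof safe
    fix A assume A: "A \<subseteq> cube n" "m = card A"
    have "{x \<in> cube n. ?h A x = 1} = A" "{x \<in> cube n. ?h A x = -1} = cube n - A"
      using A by auto
    moreover have "card (cube n - A) = m"
      using A m by (simp add: card_Diff_subset finite_subset[OF A(1)])
    ultimately show "balanced n (?h A)"
      using A by (auto simp: balanced_def bool_fun_def)
  qed
  have fin: "finite {f. balanced n f}"
    by (rule finite_subset[OF _ finite_bool_fun[of n]]) (auto simp: balanced_def)
  have "(2 * m) choose m = card {A. A \<subseteq> cube n \<and> card A = m}"
    using n_subsets[OF finite_cube, of n m] m by simp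
  also have "\<dots> \<le> card {f. balanced n f}"
    using inj sub fin by (rule card_inj_on_le)
  finally have "real ((2 * m) choose m) \<le> real (card {f. balanced n f})" by simp
  moreover have "4 ^ m / (2 * real m) \<le> real ((2 * m) choose m)"
    using m(2) by (rule central_binomial_lower_bound)
  moreover have "4 ^ m / (2 * real m) = 2 ^ (2 ^ n) / 2 ^ n"
  proof -
    have "(4::real) ^ m = 2 ^ (2 * m)" by (simp add: power_mult)
    moreover have "2 * real m = 2 ^ n" using m(1) by (metis of_nat_mult of_nat_numeral of_nat_power)
    ultimately show ?thesis using m(1) by simp
  qed
  ultimately show ?thesis by linarith
qed

text \<open>This is the generating function of the Hamming distance to \<open>f0\<close>: every
  point contributes independently a factor 1 for agreement or \<open>\<theta>\<close> for
  disagreement.\<close>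

lemma sum_bool_fun_power_dist:
  fixes \<theta> :: real
  assumes "f0 \<in> bool_fun n"
  shows "(\<Sum>f\<in>bool_fun n. \<theta> ^ card {z \<in> cube n. f z \<noteq> f0 z}) = (1 + \<theta>) ^ (2 ^ n)"
proof -
  have "(\<Sum>f\<in>bool_fun n. \<theta> ^ card {z \<in> cube n. f z \<noteq> f0 z})
      = (\<Sum>f\<in>cube n \<rightarrow>\<^sub>E {-1, 1}. \<Prod>z\<in>cube n. if f z \<noteq> f0 z then \<theta> else 1)"
    by (simp add: bool_fun_def prod.If_cases Int_def)
  also have "\<dots> = (\<Prod>z\<in>cube n. \<Sum>b\<in>{-1, 1}. if b \<noteq> f0 z then \<theta> else 1)"
    by (subst prod_sum_PiE) auto
  also have "\<dots> = (\<Prod>z\<in>cube n. 1 + \<theta>)"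
    using bool_fun_cases[OF assms] by (intro prod.cong refl) fastforce
  finally show ?thesis by simp
qed

text \<open>A Chernoff bound for the volume of a Hamming ball: since
  \<open>\<theta> \<le> 1\<close>, every tuple in the ball has weight at least
  \<open>\<theta> powr t\<close>, and the total weight of all tuples is known.\<close>

lemma card_close_tuples_le:
  fixes \<theta> t :: real
  assumes f0: "\<And>i. i < k \<Longrightarrow> f0 i \<in> bool_fun n" and \<theta>: "0 < \<theta>" "\<theta> \<le> 1"
  shows "real (card {f \<in> {..<k} \<rightarrow>\<^sub>E bool_fun n. (\<Sum>i<k. real (card {z \<in> cube n. f i z \<noteq> f0 i z})) \<le> t})
    \<le> \<theta> powr - t * (1 + \<theta>) ^ (k * 2 ^ n)"
proof -
  let ?dist = "\<lambda>f i. card {z \<in> cube n. f i z \<noteq> f0 i z}"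
  let ?T = "{..<k} \<rightarrow>\<^sub>E bool_fun n"
  let ?C = "{f \<in> ?T. (\<Sum>i<k. real (?dist f i)) \<le> t}"
  have fin: "finite ?T" by (simp add: finite_PiE)
  have "real (card ?C) * \<theta> powr t = (\<Sum>f\<in>?C. \<theta> powr t)" by simp
  also have "\<dots> \<le> (\<Sum>f\<in>?C. \<Prod>i<k. \<theta> ^ ?dist f i)"
  proof (rule sum_mono)
    fix f assume "f \<in> ?C"
    then have "real (\<Sum>i<k. ?dist f i) \<le> t" by simp
    then have "\<theta> powr t \<le> \<theta> powr real (\<Sum>i<k. ?dist f i)"
      using \<theta> by (intro powr_mono') auto
    also have "\<dots> = (\<Prod>i<k. \<theta> ^ ?dist f i)"
      using \<theta> by (subst powr_realpow) (auto simp: power_sum)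
    finally show "\<theta> powr t \<le> (\<Prod>i<k. \<theta> ^ ?dist f i)" .
  qed
  also have "\<dots> \<le> (\<Sum>f\<in>?T. \<Prod>i<k. \<theta> ^ ?dist f i)"
    using fin less_imp_le[OF \<theta>(1)] by (intro sum_mono2 prod_nonneg zero_le_power) (assumption | blast)+
  also have "\<dots> = (\<Prod>i<k. \<Sum>f\<in>bool_fun n. \<theta> ^ card {z \<in> cube n. f z \<noteq> f0 i z})"
    by (subst prod_sum_PiE) auto
  also have "\<dots> = (\<Prod>i<k. (1 + \<theta>) ^ (2 ^ n))"
    using f0 by (intro prod.cong refl sum_bool_fun_power_dist) auto
  also have "\<dots> = (1 + \<theta>) ^ (k * 2 ^ n)"
    by (simp add: mult.commute flip: power_mult)
  finally show ?thesis
    using \<theta> by (simp add: powr_minus field_simps)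
qed

text \<open>All tuples served by \<open>h\<close> lie in a Hamming ball around any one of them, here
  \<open>f0\<close>, and the ball is counted by \<open>card_close_tuples_le\<close>.\<close>

lemma card_agreeing_tuples_le:
  fixes k n :: nat
  assumes k: "k \<ge> 1"
  defines "U \<equiv> pmf_of_set (cube (k * n))"
  shows "real (card {f \<in> {..<k} \<rightarrow>\<^sub>E {g. balanced n g}.
      accuracy U (lift_fun n k (majority k) f) h \<ge> 0.99}) \<le> 2 powr (real k * 2 ^ n / 2)"
proof (cases "{f \<in> {..<k} \<rightarrow>\<^sub>E {g. balanced n g}. accuracy U (lift_fun n k (majority k) f) h \<ge> 0.99} = {}")
  case False
  let ?F = "lift_fun n k (majority k)"
  let ?B = "{f \<in> {..<k} \<rightarrow>\<^sub>E {g. balanced n g}. accuracy U (?F f) h \<ge> 0.99}"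
  let ?K = "real k * 2 ^ n"
  from False obtain f0 where f0: "f0 \<in> {..<k} \<rightarrow>\<^sub>E {g. balanced n g}" "accuracy U (?F f0) h \<ge> 0.99"
    by blast
  have f0b: "balanced n (f0 i)" if "i < k" for i using f0(1) that by auto
  have acc: "accuracy U (?F f) h = 1 - real (card {X \<in> cube (k * n). h X \<noteq> ?F f X}) / 2 ^ (k * n)" for f
  proof -
    have "accuracy U (?F f) h = real (card {X \<in> cube (k * n). h X = ?F f X}) / 2 ^ (k * n)"
      by (simp add: accuracy_def U_def measure_pmf_of_set Int_def)
    moreover have "card {X \<in> cube (k * n). h X = ?F f X} + card {X \<in> cube (k * n). h X \<noteq> ?F f X} = 2 ^ (k * n)"
      by (subst card_Un_disjoint[symmetric]) (auto simp: set_eq_iff simp flip: card_cube intro!: arg_cong[where f = card])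
    then have "real (card {X \<in> cube (k * n). h X = ?F f X}) + real (card {X \<in> cube (k * n). h X \<noteq> ?F f X}) = 2 ^ (k * n)"
      by (simp flip: of_nat_add)
    ultimately show ?thesis by (simp add: field_simps)
  qed
  \<comment> \<open>The two errors of \<open>h\<close> add up to a disagreement of at most 0.02,
    that is, a correlation of at least 0.96. So the deficits \<open>1 - \<rho>\<close> have sum at
    most \<open>4 * k * 0.04 = 0.16 * k\<close>, and each is twice a relative distance.\<close>
  have close: "(\<Sum>i<k. real (card {z \<in> cube n. f i z \<noteq> f0 i z})) \<le> 0.08 * ?K" if f: "f \<in> ?B" for f
  proof -
    have fb: "balanced n (f i)" if "i < k" for i using f that by auto
    have pm: "?F f X \<in> {-1, 1}" "?F f0 X \<in> {-1, 1}" if "X \<in> cube (k * n)" for X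
      using bool_fun_cases[OF lift_fun_bool_fun[OF majority_bool_fun] that] fb f0b
      by (force intro: balanced_bool_fun)+
    have "{X \<in> cube (k * n). ?F f X \<noteq> ?F f0 X}
        \<subseteq> {X \<in> cube (k * n). h X \<noteq> ?F f X} \<union> {X \<in> cube (k * n). h X \<noteq> ?F f0 X}" by auto
    then have "card {X \<in> cube (k * n). ?F f X \<noteq> ?F f0 X}
        \<le> card {X \<in> cube (k * n). h X \<noteq> ?F f X} + card {X \<in> cube (k * n). h X \<noteq> ?F f0 X}"
      by (intro order_trans[OF card_mono card_Un_le]) auto
    moreover have "real (card {X \<in> cube (k * n). h X \<noteq> ?F f X}) \<le> 0.01 * 2 ^ (k * n)"
      "real (card {X \<in> cube (k * n). h X \<noteq> ?F f0 X}) \<le> 0.01 * 2 ^ (k * n)"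
      using f f0(2) by (auto simp: acc field_simps)
    ultimately have dis: "real (card {X \<in> cube (k * n). ?F f X \<noteq> ?F f0 X}) \<le> 0.02 * 2 ^ (k * n)"
      by linarith
    have "2 ^ (k * n) - 2 * real (card {X \<in> cube (k * n). ?F f X \<noteq> ?F f0 X})
        = (\<Sum>X\<in>cube (k * n). 1 - 2 * (if ?F f X \<noteq> ?F f0 X then 1 else 0))"
      by (simp add: sum_subtractf sum.If_cases Int_def flip: sum_distrib_left)
    also have "\<dots> = (\<Sum>X\<in>cube (k * n). real_of_int (?F f X * ?F f0 X))"
      using pm by (intro sum.cong refl) fastforce
    also have "\<dots> \<le> 2 ^ (k * n) * (1 - (\<Sum>i<k. 1 - correlation n (f i) (f0 i)) / (4 * real k))"
      using k fb f0b by (rule sum_lift_majority_le)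
    finally have "2 ^ (k * n) * ((\<Sum>i<k. 1 - correlation n (f i) (f0 i)) / (4 * real k)) \<le> 2 ^ (k * n) * 0.04"
      using dis by (simp add: right_diff_distrib)
    then have "(\<Sum>i<k. 1 - correlation n (f i) (f0 i)) / (4 * real k) \<le> 0.04"
      by (rule mult_left_le_imp_le) simp
    then have "(\<Sum>i<k. 1 - correlation n (f i) (f0 i)) \<le> 0.16 * real k"
      using k by (simp add: field_simps)
    moreover have "(\<Sum>i<k. 1 - correlation n (f i) (f0 i))
        = (\<Sum>i<k. real (card {z \<in> cube n. f i z \<noteq> f0 i z})) * (2 / 2 ^ n)"
      unfolding sum_distrib_right
      by (intro sum.cong refl) (use fb f0b in \<open>simp add: correlation_bool_fun(1) balanced_bool_fun\<close>)
    ultimately show ?thesis by (simp add: field_simps)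
  qed
  have "?B \<subseteq> {f \<in> {..<k} \<rightarrow>\<^sub>E bool_fun n.
      (\<Sum>i<k. real (card {z \<in> cube n. f i z \<noteq> f0 i z})) \<le> 0.08 * ?K}"
    using close by (auto intro: balanced_bool_fun)
  then have "real (card ?B) \<le> real (card {f \<in> {..<k} \<rightarrow>\<^sub>E bool_fun n.
      (\<Sum>i<k. real (card {z \<in> cube n. f i z \<noteq> f0 i z})) \<le> 0.08 * ?K})"
    by (intro of_nat_mono card_mono) (simp_all add: finite_PiE)
  \<comment> \<open>With \<open>\<theta> = 1 / 16\<close> the first factor is
    \<open>2 powr (0.32 * ?K)\<close>, and \<open>(17 / 16) ^ 8 \<le> 2\<close> bounds the second by
    \<open>2 powr (0.125 * ?K)\<close>. The exponents add up to \<open>0.445 * ?K\<close>.\<close>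
  also have "\<dots> \<le> (1 / 16) powr - (0.08 * ?K) * (1 + 1 / 16) ^ (k * 2 ^ n)"
    using f0b by (intro card_close_tuples_le balanced_bool_fun) auto
  also have "(1 / 16) powr - (0.08 * ?K) = 2 powr (0.32 * ?K)"
  proof -
    have e: "1 / 16 = 2 powr (-4 :: real)" by (simp add: powr_minus powr_numeral)
    show ?thesis unfolding e powr_powr by simp
  qed
  also have "(1 + 1 / 16 :: real) ^ (k * 2 ^ n) \<le> 2 powr (0.125 * ?K)"
  proof -
    have "(17 / 16 :: real) = ((17 / 16) powr 8) powr 0.125" unfolding powr_powr by simp
    also have "\<dots> \<le> 2 powr 0.125"
      by (intro powr_mono2) (simp_all add: powr_numeral power_divide)
    finally have "(1 + 1 / 16 :: real) ^ (k * 2 ^ n) \<le> (2 powr 0.125) ^ (k * 2 ^ n)"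
      by (intro power_mono) auto
    also have "\<dots> = 2 powr (0.125 * ?K)"
      by (subst powr_realpow[symmetric]) (simp_all add: powr_powr)
    finally show ?thesis .
  qed
  also have "2 powr (0.32 * ?K) * 2 powr (0.125 * ?K) \<le> 2 powr (?K / 2)"
  proof -
    have "0.32 * ?K + 0.125 * ?K \<le> ?K / 2" by simp
    then show ?thesis unfolding powr_add[symmetric] by (rule powr_mono) simp
  qed
  finally show ?thesis by simp
next
  case True
  then show ?thesis by (simp only: card.empty) simp
qed

text \<open>Logarithms are taken in \<open>learner_counting\<close>: the tuples hold at least
  \<open>?K - k * n\<close> bits, one hypothesis leaves \<open>?K / 2\<close> of them open, and the
  labels supply \<open>m\<close>. The losses \<open>k * n\<close> and
  \<open>log 2 (1 / (1 - \<delta>))\<close> are at most \<open>?K / 8\<close> each.\<close>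

lemma sample_lower_bound:
  assumes k: "k \<ge> 1" and \<delta>: "\<delta> < 1" and n: "n \<ge> 6" "2 ^ n \<ge> 8 * log 2 (1 / (1 - \<delta>))"
    and A: "is_learner (k * n) A"
    and succ: "\<And>F. F \<in> Lift n k (majority k) \<Longrightarrow>
      measure_pmf.prob (output_pmf A m (pmf_of_set (cube (k * n))) F)
        {h. accuracy (pmf_of_set (cube (k * n))) F h \<ge> 0.99} \<ge> 1 - \<delta>"
  shows "real m \<ge> 1 / 4 * real k * 2 ^ n"
proof -
  let ?U = "pmf_of_set (cube (k * n))"
  let ?F = "lift_fun n k (majority k)"
  let ?I = "{..<k} \<rightarrow>\<^sub>E {g. balanced n g}"
  let ?K = "real k * 2 ^ n"
  have finb: "finite {g. balanced n g}"
    by (rule finite_subset[OF _ finite_bool_fun[of n]]) (auto simp: balanced_def)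
  have "real (card ?I) * (1 - \<delta>) \<le> 2 ^ m * 2 powr (?K / 2)"
  proof (rule learner_counting[OF _ A, where F = ?F and G = "\<lambda>f. {h. accuracy ?U (?F f) h \<ge> 0.99}"])
    show "finite ?I" using finb by (simp add: finite_PiE)
    show "?F f \<in> bool_fun (k * n)" if "f \<in> ?I" for f
      using that by (intro lift_fun_bool_fun majority_bool_fun balanced_bool_fun) auto
    show "real (card {f \<in> ?I. h \<in> {h. accuracy ?U (?F f) h \<ge> 0.99}}) \<le> 2 powr (?K / 2)" for h
      using card_agreeing_tuples_le[OF k, of n h] by simp
    show "1 - \<delta> \<le> measure_pmf.prob (output_pmf A m ?U (?F f)) {h. accuracy ?U (?F f) h \<ge> 0.99}" if "f \<in> ?I" for f
      using that by (intro succ) (auto simp: Lift_eq)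
  qed simp
  moreover have "2 powr (?K - real k * real n) \<le> real (card ?I)"
  proof -
    have "2 powr (2 ^ n - real n) = (2 ^ (2 ^ n) / 2 ^ n :: real)"
      using powr_realpow[of 2 "2 ^ n"] powr_realpow[of 2 n] by (simp add: powr_diff)
    moreover have "2 powr (?K - real k * real n) = (2 powr (2 ^ n - real n)) powr real k"
      by (simp add: powr_powr algebra_simps)
    ultimately have "2 powr (?K - real k * real n) = (2 ^ (2 ^ n) / 2 ^ n) ^ k"
      by (simp add: powr_realpow)
    also have "\<dots> \<le> real (card {g. balanced n g}) ^ k"
      using n by (intro power_mono card_balanced_ge) auto
    also have "\<dots> = real (card ?I)" by (simp add: card_PiE)
    finally show ?thesis .
  qed
  ultimately have "2 powr (?K - real k * real n) * (1 - \<delta>) \<le> 2 powr real m * 2 powr (?K / 2)"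
    using \<delta> by (simp add: powr_realpow) (rule order_trans[OF mult_right_mono], auto)
  moreover have "1 - \<delta> = 2 powr - log 2 (1 / (1 - \<delta>))"
    using \<delta> by (simp add: powr_minus log_divide)
  ultimately have "2 powr (?K - real k * real n + - log 2 (1 / (1 - \<delta>))) \<le> 2 powr (real m + ?K / 2)"
    by (simp only: powr_add)
  then have "?K - real k * real n - log 2 (1 / (1 - \<delta>)) \<le> real m + ?K / 2"
    by simp
  moreover have "8 * log 2 (1 / (1 - \<delta>)) \<le> ?K"
  proof -
    have "1 * 2 ^ n \<le> ?K" using k by (intro mult_right_mono) auto
    then show ?thesis using n(2) by linarith
  qed
  moreover have "8 * (real k * real n) \<le> ?K"
  proof -
    \<comment> \<open>This inequality is the source of the bound \<open>6 \<le> n\<close>; it fails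
      at 5.\<close>
    have "8 * n \<le> 2 ^ n" using n(1) by (induction n rule: nat_induct_at_least) auto
    then have "8 * real n \<le> 2 ^ n" by (metis of_nat_le_iff of_nat_mult of_nat_numeral of_nat_power)
    then have "real k * (8 * real n) \<le> real k * 2 ^ n" by (intro mult_left_mono) auto
    then show ?thesis by simp
  qed
  ultimately show ?thesis by linarith
qed

section \<open>Concentration for functions of a sample\<close>

lemma finite_set_replicate_pmf: "finite (set_pmf D) \<Longrightarrow> finite (set_pmf (replicate_pmf m D))"
  by (simp add: set_replicate_pmf finite_lists_of_length)

lemma expectation_replicate_Suc:
  fixes G :: "'a list \<Rightarrow> real"
  assumes "finite (set_pmf D)"
  shows "measure_pmf.expectation (replicate_pmf (Suc m) D) G
    = measure_pmf.expectation D (\<lambda>x. measure_pmf.expectation (replicate_pmf m D) (\<lambda>xs. G (x # xs)))"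
proof -
  have "replicate_pmf (Suc m) D = bind_pmf D (\<lambda>x. map_pmf ((#) x) (replicate_pmf m D))"
    by (simp add: map_pmf_def)
  then have "measure_pmf.expectation (replicate_pmf (Suc m) D) G
      = (\<Sum>x\<in>set_pmf D. pmf D x *\<^sub>R measure_pmf.expectation (map_pmf ((#) x) (replicate_pmf m D)) G)"
    using assms by (simp only:, subst pmf_expectation_bind) (auto simp: finite_set_replicate_pmf)
  also have "\<dots> = measure_pmf.expectation D (\<lambda>x. measure_pmf.expectation (replicate_pmf m D) (\<lambda>xs. G (x # xs)))"
    using assms by (subst integral_measure_pmf[of "set_pmf D"]) auto
  finally show ?thesis .
qed

lemma expectation_pmf_mono:
  fixes f g :: "'a \<Rightarrow> real"
  assumes "finite (set_pmf p)" "\<And>x. x \<in> set_pmf p \<Longrightarrow> f x \<le> g x"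
  shows "measure_pmf.expectation p f \<le> measure_pmf.expectation p g"
  using assms by (intro integral_mono_AE integrable_measure_pmf_finite) (auto simp: AE_measure_pmf_iff)

lemma expectation_pmf_const_ge:
  fixes f :: "'a \<Rightarrow> real"
  assumes "finite (set_pmf p)" "\<And>x. x \<in> set_pmf p \<Longrightarrow> c \<le> f x"
  shows "c \<le> measure_pmf.expectation p f"
  using expectation_pmf_mono[OF assms(1), of "\<lambda>_. c" f] assms(2) by simp

lemma expectation_pmf_const_le:
  fixes f :: "'a \<Rightarrow> real"
  assumes "finite (set_pmf p)" "\<And>x. x \<in> set_pmf p \<Longrightarrow> f x \<le> c"
  shows "measure_pmf.expectation p f \<le> c"
  using expectation_pmf_mono[OF assms(1), of f "\<lambda>_. c"] assms(2) by simp

lemma expectation_square_shift: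
  fixes f :: "'a \<Rightarrow> real"
  assumes "finite (set_pmf p)"
  shows "measure_pmf.expectation p (\<lambda>x. (f x - c) ^ 2)
    = measure_pmf.variance p f + (measure_pmf.expectation p f - c) ^ 2"
proof -
  let ?\<mu> = "measure_pmf.expectation p f"
  note [simp] = integrable_measure_pmf_finite[OF assms]
  have "measure_pmf.expectation p (\<lambda>x. (f x - c) ^ 2)
      = measure_pmf.expectation p (\<lambda>x. (f x - ?\<mu>) ^ 2 + (2 * (?\<mu> - c) * (f x - ?\<mu>) + (?\<mu> - c) ^ 2))"
    by (intro arg_cong[where f = "measure_pmf.expectation p"] ext) (simp add: power2_eq_square algebra_simps)
  also have "\<dots> = measure_pmf.variance p f + (2 * (?\<mu> - c) * (?\<mu> - ?\<mu>) + (?\<mu> - c) ^ 2)"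
    by simp
  finally show ?thesis by simp
qed

text \<open>Induction on the first draw. Given this draw, the remaining \<open>m\<close> draws
  contribute a variance of at most \<open>m * B ^ 2\<close>, and the conditional mean differs from
  the overall mean by at most \<open>B\<close>.\<close>

lemma bounded_difference_variance:
  fixes G :: "'a list \<Rightarrow> real"
  assumes fin: "finite (set_pmf D)"
    and bd: "\<And>xs j x. length xs = m \<Longrightarrow> set xs \<subseteq> set_pmf D \<Longrightarrow> x \<in> set_pmf D \<Longrightarrow> j < m \<Longrightarrow>
      \<bar>G xs - G (xs[j := x])\<bar> \<le> B"
  shows "measure_pmf.variance (replicate_pmf m D) G \<le> real m * B ^ 2"
  using bd
proof (induction m arbitrary: G)
  case (Suc m)
  let ?R = "replicate_pmf m D"
  define g where "g = (\<lambda>x. measure_pmf.expectation ?R (\<lambda>xs. G (x # xs)))"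
  define e where "e = measure_pmf.expectation D g"
  note int = integrable_measure_pmf_finite[OF finite_set_replicate_pmf[OF fin]]
  have e: "measure_pmf.expectation (replicate_pmf (Suc m) D) G = e"
    unfolding expectation_replicate_Suc[OF fin] e_def g_def ..
  have B: "0 \<le> B"
  proof -
    obtain x where x: "x \<in> set_pmf D" using set_pmf_not_empty[of D] by blast
    have "set (replicate (Suc m) x) \<subseteq> set_pmf D" using x by (auto split: if_splits)
    then show ?thesis using Suc.prems[OF length_replicate _ x, of x 0] by simp
  qed
  have sets: "length xs = m" "set xs \<subseteq> set_pmf D" if "xs \<in> set_pmf ?R" for xs
    using that by (auto simp: set_replicate_pmf)
  have g_diff: "\<bar>g x - g y\<bar> \<le> B" if "x \<in> set_pmf D" "y \<in> set_pmf D" for x y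
  proof -
    have "g x - g y = measure_pmf.expectation ?R (\<lambda>xs. G (x # xs) - G (y # xs))"
      unfolding g_def by (rule Bochner_Integration.integral_diff[symmetric]) (rule int)+
    moreover have "\<bar>G (x # xs) - G (y # xs)\<bar> \<le> B" if "xs \<in> set_pmf ?R" for xs
      using Suc.prems[of "x # xs" y 0] sets[OF that] \<open>x \<in> _\<close> \<open>y \<in> _\<close> by auto
    ultimately show ?thesis
      using expectation_pmf_const_le[OF finite_set_replicate_pmf[OF fin], of m "\<lambda>xs. G (x # xs) - G (y # xs)" B]
        expectation_pmf_const_ge[OF finite_set_replicate_pmf[OF fin], of m "- B" "\<lambda>xs. G (x # xs) - G (y # xs)"]
      by (simp add: abs_le_iff) (smt (verit))
  qed
  have inner: "measure_pmf.expectation ?R (\<lambda>xs. (G (x # xs) - e) ^ 2) \<le> real m * B ^ 2 + B ^ 2"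
    if x: "x \<in> set_pmf D" for x
  proof -
    have "measure_pmf.variance ?R (\<lambda>xs. G (x # xs)) \<le> real m * B ^ 2"
    proof (rule Suc.IH)
      fix xs j y assume "length xs = m" "set xs \<subseteq> set_pmf D" "y \<in> set_pmf D" "j < m"
      then show "\<bar>G (x # xs) - G (x # xs[j := y])\<bar> \<le> B"
        using Suc.prems[of "x # xs" y "Suc j"] x by simp
    qed
    moreover have "(g x - e) ^ 2 \<le> B ^ 2"
    proof -
      have "g x - B \<le> e"
        unfolding e_def using g_diff[OF x] by (intro expectation_pmf_const_ge fin) (smt (verit))
      moreover have "e \<le> g x + B"
        unfolding e_def using g_diff[OF x] by (intro expectation_pmf_const_le fin) (smt (verit))
      ultimately show ?thesis using B by (intro power2_le_iff_abs_le[THEN iffD2]) auto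
    qed
    moreover have "measure_pmf.expectation ?R (\<lambda>xs. (G (x # xs) - e) ^ 2)
        = measure_pmf.variance ?R (\<lambda>xs. G (x # xs)) + (g x - e) ^ 2"
      unfolding g_def by (rule expectation_square_shift[OF finite_set_replicate_pmf[OF fin]])
    ultimately show ?thesis by linarith
  qed
  have "measure_pmf.variance (replicate_pmf (Suc m) D) G
      = measure_pmf.expectation D (\<lambda>x. measure_pmf.expectation ?R (\<lambda>xs. (G (x # xs) - e) ^ 2))"
    unfolding e by (rule expectation_replicate_Suc[OF fin])
  also have "\<dots> \<le> real m * B ^ 2 + B ^ 2"
    by (intro expectation_pmf_const_le fin inner)
  finally show ?case by (simp add: algebra_simps)
qed (simp add: integral_return)

text \<open>Chebyshev's inequality; its polynomial tail is enough because \<open>2 ^ n\<close> will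
  dominate a power of \<open>k\<close>.\<close>

lemma bounded_difference_deviation:
  fixes G :: "'a list \<Rightarrow> real"
  assumes fin: "finite (set_pmf D)"
    and bd: "\<And>xs j x. length xs = m \<Longrightarrow> set xs \<subseteq> set_pmf D \<Longrightarrow> x \<in> set_pmf D \<Longrightarrow> j < m \<Longrightarrow>
      \<bar>G xs - G (xs[j := x])\<bar> \<le> B"
    and t: "t > 0"
  shows "measure_pmf.prob (replicate_pmf m D)
      {xs. t \<le> \<bar>G xs - measure_pmf.expectation (replicate_pmf m D) G\<bar>} \<le> real m * B ^ 2 / t ^ 2"
proof -
  have "measure_pmf.prob (replicate_pmf m D)
      {xs. t \<le> \<bar>G xs - measure_pmf.expectation (replicate_pmf m D) G\<bar>}
      \<le> measure_pmf.variance (replicate_pmf m D) G / t ^ 2"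
    using measure_pmf.Chebyshev_inequality[of G "replicate_pmf m D" t,
        OF _ integrable_measure_pmf_finite[OF finite_set_replicate_pmf[OF fin]] t] by simp
  also have "\<dots> \<le> real m * B ^ 2 / t ^ 2"
    using bounded_difference_variance[OF fin bd] by (intro divide_right_mono) auto
  finally show ?thesis .
qed

lemma expectation_sum_list_replicate:
  fixes \<phi> :: "'a \<Rightarrow> real"
  assumes "finite (set_pmf D)"
  shows "measure_pmf.expectation (replicate_pmf m D) (\<lambda>xs. \<Sum>x\<leftarrow>xs. \<phi> x) = real m * measure_pmf.expectation D \<phi>"
proof (induction m)
  case (Suc m)
  note [simp] = integrable_measure_pmf_finite[OF assms]
    integrable_measure_pmf_finite[OF finite_set_replicate_pmf[OF assms]]
  show ?case
    unfolding expectation_replicate_Suc[OF assms] by (simp add: Suc.IH algebra_simps)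
qed simp

lemma sum_list_update_real:
  fixes \<phi> :: "'a \<Rightarrow> real"
  shows "j < length xs \<Longrightarrow> (\<Sum>y\<leftarrow>xs[j := x]. \<phi> y) = (\<Sum>y\<leftarrow>xs. \<phi> y) - \<phi> (xs ! j) + \<phi> x"
  by (induction xs arbitrary: j) (auto split: nat.split)

lemma sample_mean_deviation:
  fixes \<phi> :: "'a \<Rightarrow> real"
  assumes fin: "finite (set_pmf D)" and \<phi>: "\<And>x. x \<in> set_pmf D \<Longrightarrow> \<bar>\<phi> x\<bar> \<le> 1" and t: "t > 0" and m: "m > 0"
  shows "measure_pmf.prob (replicate_pmf m D)
      {xs. real m * t \<le> \<bar>(\<Sum>x\<leftarrow>xs. \<phi> x) - real m * measure_pmf.expectation D \<phi>\<bar>} \<le> 4 / (real m * t ^ 2)"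
proof -
  have "measure_pmf.prob (replicate_pmf m D)
      {xs. real m * t \<le> \<bar>(\<Sum>x\<leftarrow>xs. \<phi> x) - measure_pmf.expectation (replicate_pmf m D) (\<lambda>xs. \<Sum>x\<leftarrow>xs. \<phi> x)\<bar>}
      \<le> real m * 2 ^ 2 / (real m * t) ^ 2"
  proof (rule bounded_difference_deviation[OF fin])
    fix xs j x assume *: "length xs = m" "set xs \<subseteq> set_pmf D" "x \<in> set_pmf D" "j < m"
    then have "\<bar>\<phi> (xs ! j)\<bar> \<le> 1" "\<bar>\<phi> x\<bar> \<le> 1" by (auto intro!: \<phi>)
    then show "\<bar>(\<Sum>x\<leftarrow>xs. \<phi> x) - (\<Sum>x\<leftarrow>xs[j := x]. \<phi> x)\<bar> \<le> 2"
      using * by (simp add: sum_list_update_real abs_le_iff)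
  qed (use t m in simp)
  also have "real m * 2 ^ 2 / (real m * t) ^ 2 = 4 / (real m * t ^ 2)"
    using m by (simp add: power2_eq_square)
  finally show ?thesis by (simp add: expectation_sum_list_replicate[OF fin])
qed

section \<open>The table of first labels\<close>

primrec first_label :: "('a \<Rightarrow> 'b) \<Rightarrow> ('a \<times> int) list \<Rightarrow> 'b \<Rightarrow> int" where
  "first_label key [] z = 0"
| "first_label key (s # S) z = (if key (fst s) = z then snd s else first_label key S z)"

lemma abs_first_label_le: "(\<And>s. s \<in> set S \<Longrightarrow> \<bar>snd s\<bar> \<le> 1) \<Longrightarrow> \<bar>first_label key S z\<bar> \<le> 1"
  by (induction S) auto

text \<open>Replacing one sample point affects only its old and its new key. This is the source of
  the bounded differences of the vote.\<close>

lemma first_label_update: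
  "j < length S \<Longrightarrow> z \<noteq> key (fst (S ! j)) \<Longrightarrow> z \<noteq> key (fst s) \<Longrightarrow>
    first_label key (S[j := s]) z = first_label key S z"
  by (induction S arbitrary: j) (auto simp: nth_Cons split: nat.splits)

text \<open>Conditioning on the first draw gives \<open>t (m + 1) = q + (1 - p) * t m\<close> for
  the mean \<open>t m\<close>, where \<open>p\<close> is the probability of the key \<open>z\<close>
  and \<open>q\<close> the integral of \<open>F\<close> over it. The term \<open>j\<close> of the
  geometric sum is the probability that \<open>j\<close> draws all miss \<open>z\<close>.\<close>

lemma expectation_first_label:
  fixes F :: "'a \<Rightarrow> int"
  assumes fin: "finite (set_pmf D)"
  shows "measure_pmf.expectation (replicate_pmf m D) (\<lambda>xs. real_of_int (first_label key (map (\<lambda>x. (x, F x)) xs) z))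
    = measure_pmf.expectation D (\<lambda>x. if key x = z then real_of_int (F x) else 0)
      * (\<Sum>j<m. (1 - measure_pmf.prob D {x. key x = z}) ^ j)"
proof (induction m)
  case (Suc m)
  let ?q = "measure_pmf.expectation D (\<lambda>x. if key x = z then real_of_int (F x) else 0)"
  let ?p = "measure_pmf.prob D {x. key x = z}"
  let ?t = "\<lambda>m. measure_pmf.expectation (replicate_pmf m D)
    (\<lambda>xs. real_of_int (first_label key (map (\<lambda>x. (x, F x)) xs) z))"
  note [simp] = integrable_measure_pmf_finite[OF fin]
  have "?t (Suc m) = measure_pmf.expectation D
      (\<lambda>x. (if key x = z then real_of_int (F x) else 0) + (1 - indicator {x. key x = z} x) * ?t m)"
    unfolding expectation_replicate_Suc[OF fin]
    by (intro arg_cong[where f = "measure_pmf.expectation D"] ext) (auto simp: indicator_def)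
  also have "\<dots> = ?q + (1 - ?p) * ?t m"
    by simp
  also have "\<dots> = ?q * (\<Sum>j<Suc m. (1 - ?p) ^ j)"
    unfolding Suc.IH sum.lessThan_Suc_shift by (simp add: algebra_simps sum_distrib_left)
  finally show ?case .
qed simp

section \<open>The voting learner\<close>

text \<open>Hoeffding's lemma under the uniform distribution, for a variable in an interval of
  length 2.\<close>

lemma cube_hoeffding_mgf:
  fixes g :: "point \<Rightarrow> real"
  assumes g: "\<And>z. z \<in> cube n \<Longrightarrow> \<bar>g z\<bar> \<le> 1" and l: "l > 0"
  shows "(\<Sum>z\<in>cube n. exp (l * (g z - (\<Sum>z\<in>cube n. g z) / 2 ^ n))) \<le> 2 ^ n * exp (l ^ 2 / 2)"
proof -
  let ?M = "measure_pmf (pmf_of_set (cube n))"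
  interpret interval_bounded_random_variable ?M g "-1" 1
    by unfold_locales (use g in \<open>auto simp: AE_measure_pmf_iff abs_le_iff\<close>)
  have e: "measure_pmf.expectation (pmf_of_set (cube n)) g = (\<Sum>z\<in>cube n. g z) / 2 ^ n"
    by (simp add: integral_pmf_of_set)
  define G where "G = (\<lambda>z. exp (l * (g z - (\<Sum>z\<in>cube n. g z) / 2 ^ n)))"
  have "ennreal (measure_pmf.expectation (pmf_of_set (cube n)) G) = nn_integral ?M G"
    by (intro nn_integral_eq_integral[symmetric] integrable_measure_pmf_finite) (auto simp: G_def)
  also have "\<dots> \<le> ennreal (exp (l\<^sup>2 * (1 - (-1))\<^sup>2 / 8))"
    using Hoeffdings_lemma_nn_integral[OF l] unfolding e G_def .
  also have "l\<^sup>2 * (1 - (-1))\<^sup>2 / 8 = l ^ 2 / 2" by simp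
  finally have "measure_pmf.expectation (pmf_of_set (cube n)) G \<le> exp (l ^ 2 / 2)"
    by simp
  then have "sum G (cube n) \<le> 2 ^ n * exp (l ^ 2 / 2)"
    by (simp add: integral_pmf_of_set field_simps)
  then show ?thesis unfolding G_def .
qed

lemma cube_hoeffding_upper:
  fixes T :: "nat \<Rightarrow> point \<Rightarrow> real"
  assumes T: "\<And>i z. i < k \<Longrightarrow> z \<in> cube n \<Longrightarrow> \<bar>T i z\<bar> \<le> 1" and t: "t > 0" and k: "k \<ge> 1"
  shows "real (card {X \<in> cube (k * n). (\<Sum>i<k. T i (block n X i)) - (\<Sum>i<k. (\<Sum>z\<in>cube n. T i z) / 2 ^ n) > t})
    \<le> 2 ^ (k * n) * exp (- (t ^ 2 / (2 * real k)))"
proof -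
  define \<mu> where "\<mu> = (\<lambda>i. (\<Sum>z\<in>cube n. T i z) / 2 ^ n)"
  let ?Y = "\<lambda>X. \<Sum>i<k. T i (block n X i) - \<mu> i"
  let ?C = "{X \<in> cube (k * n). ?Y X > t}"
  \<comment> \<open>This value minimises the exponent \<open>k * l ^ 2 / 2 - l * t\<close> of the
    Chernoff bound.\<close>
  define l where "l = t / real k"
  have l: "l > 0" using t k by (simp add: l_def)
  have "real (card ?C) * exp (l * t) = (\<Sum>X\<in>?C. exp (l * t))" by simp
  also have "\<dots> \<le> (\<Sum>X\<in>?C. exp (l * ?Y X))"
    using l by (intro sum_mono) auto
  also have "\<dots> \<le> (\<Sum>X\<in>cube (k * n). exp (l * ?Y X))"
    by (intro sum_mono2) auto
  also have "\<dots> = (\<Sum>X\<in>cube (k * n). \<Prod>i<k. exp (l * (T i (block n X i) - \<mu> i)))"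
    by (simp add: sum_distrib_left exp_sum)
  also have "\<dots> = (\<Prod>i<k. \<Sum>z\<in>cube n. exp (l * (T i z - \<mu> i)))"
    by (rule sum_prod_blocks)
  also have "\<dots> \<le> (\<Prod>i<k. 2 ^ n * exp (l ^ 2 / 2))"
    unfolding \<mu>_def using T l by (intro prod_mono conjI cube_hoeffding_mgf sum_nonneg) auto
  also have "\<dots> = 2 ^ (k * n) * exp (real k * (l ^ 2 / 2))"
    by (simp only: exp_of_nat_mult prod_constant card_lessThan power_mult_distrib
      power_mult[symmetric] mult.commute[of k])
  finally have "real (card ?C) \<le> 2 ^ (k * n) * (exp (real k * (l ^ 2 / 2)) / exp (l * t))"
    by (simp add: field_simps)
  also have "exp (real k * (l ^ 2 / 2)) / exp (l * t) = exp (- (t ^ 2 / (2 * real k)))"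
  proof -
    have "real k * (l ^ 2 / 2) - l * t = - (t ^ 2 / (2 * real k))"
      using k by (simp add: l_def power2_eq_square field_simps)
    then show ?thesis by (simp flip: exp_diff)
  qed
  finally show ?thesis by (simp add: sum_subtractf \<mu>_def)
qed

lemma cube_hoeffding:
  fixes T :: "nat \<Rightarrow> point \<Rightarrow> real"
  assumes T: "\<And>i z. i < k \<Longrightarrow> z \<in> cube n \<Longrightarrow> \<bar>T i z\<bar> \<le> 1" and t: "t > 0" and k: "k \<ge> 1"
  shows "real (card {X \<in> cube (k * n). \<bar>(\<Sum>i<k. T i (block n X i)) - (\<Sum>i<k. (\<Sum>z\<in>cube n. T i z) / 2 ^ n)\<bar> > t})
    \<le> 2 ^ (k * n) * (2 * exp (- (t ^ 2 / (2 * real k))))"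
proof -
  let ?Y = "\<lambda>T X. (\<Sum>i<k. T i (block n X i)) - (\<Sum>i<k. (\<Sum>z\<in>cube n. T i z) / 2 ^ n) :: real"
  have neg: "?Y (\<lambda>i z. - T i z) X = - ?Y T X" for X
    by (simp add: sum_negf)
  have "{X \<in> cube (k * n). \<bar>?Y T X\<bar> > t}
      = {X \<in> cube (k * n). ?Y T X > t} \<union> {X \<in> cube (k * n). ?Y (\<lambda>i z. - T i z) X > t}"
    unfolding neg by auto
  then have "card {X \<in> cube (k * n). \<bar>?Y T X\<bar> > t}
      \<le> card {X \<in> cube (k * n). ?Y T X > t} + card {X \<in> cube (k * n). ?Y (\<lambda>i z. - T i z) X > t}"
    by (simp only: card_Un_le)
  moreover have "real (card {X \<in> cube (k * n). ?Y T X > t}) \<le> 2 ^ (k * n) * exp (- (t ^ 2 / (2 * real k)))"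
    using assms by (rule cube_hoeffding_upper)
  moreover have "real (card {X \<in> cube (k * n). ?Y (\<lambda>i z. - T i z) X > t}) \<le> 2 ^ (k * n) * exp (- (t ^ 2 / (2 * real k)))"
    using assms by (intro cube_hoeffding_upper) auto
  ultimately show ?thesis by linarith
qed

text \<open>Balancedness makes the vector of block values uniform on \<open>cube k\<close>. This is
  the case \<open>f' = f\<close> of the pair law, where all correlations are 1.\<close>

lemma sum_block_values:
  assumes "\<And>i. i < k \<Longrightarrow> balanced n (f i)"
  shows "(\<Sum>X\<in>cube (k * n). \<phi> (block_values n k f X)) = 2 ^ (k * n) / 2 ^ k * (\<Sum>x\<in>cube k. \<phi> x :: real)"
proof -
  have c: "correlation n (f i) (f i) = 1" if "i < k" for i
    using correlation_bool_fun(1)[OF balanced_bool_fun balanced_bool_fun, OF assms assms, OF that that] by simp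
  have "(\<Sum>X\<in>cube (k * n). \<phi> (block_values n k f X))
      = 2 ^ (k * n) / 4 ^ k * (\<Sum>x\<in>cube k. \<Sum>y\<in>cube k. \<phi> x *
        (\<Prod>i<k. 1 + correlation n (f i) (f i) * (real_of_int (x i) * real_of_int (y i))))"
    using assms assms by (rule sum_pair_block_values)
  also have "(\<Sum>x\<in>cube k. \<Sum>y\<in>cube k. \<phi> x *
        (\<Prod>i<k. 1 + correlation n (f i) (f i) * (real_of_int (x i) * real_of_int (y i))))
      = (\<Sum>x\<in>cube k. \<Sum>y\<in>cube k. if y = x then \<phi> x * 2 ^ k else 0)"
  proof (intro sum.cong refl)
    fix x y assume xy: "x \<in> cube k" "y \<in> cube k"
    have "(\<Prod>i<k. 1 + correlation n (f i) (f i) * (real_of_int (x i) * real_of_int (y i)))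
        = (\<Prod>i<k. 2 * ((1 + real_of_int (x i) * real_of_int (y i)) / 2))"
      by (intro prod.cong refl) (simp add: c)
    also have "\<dots> = 2 ^ k * (\<Prod>i<k. (1 + real_of_int (x i) * real_of_int (y i)) / 2)"
      by (simp only: prod.distrib) simp
    also have "\<dots> = (if y = x then 2 ^ k else 0)"
      unfolding prod_cube_delta[OF xy] by auto
    finally show "\<phi> x * (\<Prod>i<k. 1 + correlation n (f i) (f i) * (real_of_int (x i) * real_of_int (y i)))
        = (if y = x then \<phi> x * 2 ^ k else 0)" by simp
  qed
  also have "\<dots> = 2 ^ k * (\<Sum>x\<in>cube k. \<phi> x)"
    by (simp add: sum.delta sum_distrib_left mult.commute[of _ "2 ^ k"])
  also have "2 ^ (k * n) / 4 ^ k * (2 ^ k * (\<Sum>x\<in>cube k. \<phi> x)) = 2 ^ (k * n) / 2 ^ k * (\<Sum>x\<in>cube k. \<phi> x)"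
  proof -
    have "(4 :: real) ^ k = 2 ^ k * 2 ^ k" by (simp flip: power_mult_distrib)
    then show ?thesis by simp
  qed
  finally show ?thesis .
qed

lemma card_block_eq:
  assumes "i < k" "z \<in> cube n"
  shows "real (card {X \<in> cube (k * n). block n X i = z}) * 2 ^ n = 2 ^ (k * n)"
proof -
  have "real (card {X \<in> cube (k * n). block n X i = z})
      = (\<Sum>X\<in>cube (k * n). if block n X i = z then 1 else 0)"
    by (simp add: sum.If_cases Int_def)
  also have "\<dots> = (\<Sum>X\<in>cube (k * n). \<Prod>j<k. if j = i then (if block n X j = z then 1 else 0) else 1)"
    using assms(1) by (intro sum.cong refl) (simp add: prod.delta)
  also have "\<dots> = (\<Prod>j<k. \<Sum>y\<in>cube n. if j = i then (if y = z then 1 else 0) else 1)"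
    by (rule sum_prod_blocks)
  also have "\<dots> = (\<Prod>j<k. if j = i then 1 else 2 ^ n)"
    using assms(2) by (intro prod.cong refl) (simp add: sum.delta)
  also have "\<dots> = (2 ^ n) ^ (k - 1)"
  proof -
    have "{..<k} \<inter> - {j. j = i} = {..<k} - {i}" by auto
    then show ?thesis using assms(1) by (simp add: prod.If_cases)
  qed
  finally have "real (card {X \<in> cube (k * n). block n X i = z}) * 2 ^ n = (2 ^ n) ^ Suc (k - 1)" by simp
  then show ?thesis using assms(1) by (simp add: mult.commute[of k] power_mult)
qed

text \<open>Each threshold up to \<open>v\<close> counts 1 and each one above \<open>v\<close>
  counts -1. The interval is half-open because \<open>sign_pm 0 = 1\<close>.\<close>

lemma clamp_eq_sum_sign:
  assumes "A \<le> B"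
  shows "2 * max A (min B v) = A + B + (\<Sum>\<theta>\<in>{A<..B}. sign_pm (v - \<theta>))"
  using assms
proof (induction B rule: int_ge_induct)
  case (step B)
  have "{A<..B + 1} = insert (B + 1) {A<..B}" using step.hyps by auto
  then show ?case using step by (auto simp: sign_pm_def)
qed simp

section \<open>The learner and the selection of its threshold\<close>

definition vote :: "nat \<Rightarrow> nat \<Rightarrow> (point \<times> int) list \<Rightarrow> point \<Rightarrow> int" where
  "vote n k S X = (\<Sum>i<k. first_label (\<lambda>X. block n X i) S (block n X i))"

definition vote_hyp :: "nat \<Rightarrow> nat \<Rightarrow> (point \<times> int) list \<Rightarrow> int \<Rightarrow> bfun" where
  "vote_hyp n k S \<theta> = (\<lambda>X\<in>cube (k * n). sign_pm (vote n k S X - \<theta>))"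

definition score :: "(point \<times> int) list \<Rightarrow> bfun \<Rightarrow> int" where
  "score S h = (\<Sum>s\<leftarrow>S. h (fst s) * snd s)"

text \<open>For labels of absolute value 1 the vote lies between \<open>- k\<close> and
  \<open>k\<close>, so the two extreme candidates are the constant hypotheses 1 and -1.\<close>

definition best_threshold :: "nat \<Rightarrow> nat \<Rightarrow> (point \<times> int) list \<Rightarrow> (point \<times> int) list \<Rightarrow> int" where
  "best_threshold n k S S' = arg_min_on (\<lambda>\<theta>. - score S' (vote_hyp n k S \<theta>)) {- int k..int k + 1}"

text \<open>The first \<open>2 ^ n\<close> points fill the table and the remaining ones choose the
  threshold, so that for independent draws the candidates are independent of the validation
  sample.\<close>

definition vote_learner :: "nat \<Rightarrow> nat \<Rightarrow> learner" where
  "vote_learner n k S = (let S' = take (2 ^ n) S in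
     return_pmf (vote_hyp n k S' (best_threshold n k S' (drop (2 ^ n) S))))"

lemma vote_hyp_bool_fun: "vote_hyp n k S \<theta> \<in> bool_fun (k * n)"
  by (auto simp: vote_hyp_def bool_fun_def sign_pm_def)

lemma is_learner_vote_learner: "is_learner (k * n) (vote_learner n k)"
  by (simp add: is_learner_def vote_learner_def Let_def vote_hyp_bool_fun)

lemma best_threshold:
  "best_threshold n k S S' \<in> {- int k..int k + 1}"
  "\<theta> \<in> {- int k..int k + 1} \<Longrightarrow> score S' (vote_hyp n k S \<theta>) \<le> score S' (vote_hyp n k S (best_threshold n k S S'))"
  using arg_min_if_finite[of "{- int k..int k + 1}" "\<lambda>\<theta>. - score S' (vote_hyp n k S \<theta>)"]
    arg_min_least[of "{- int k..int k + 1}" \<theta> "\<lambda>\<theta>. - score S' (vote_hyp n k S \<theta>)"]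
  unfolding best_threshold_def[symmetric] by auto

text \<open>Choosing the threshold on fresh samples: by Chebyshev's inequality and a union bound over
  the \<open>2 k + 2\<close> candidates, the best empirical advantage is close to the best true one.\<close>

lemma validation:
  assumes D: "set_pmf D \<subseteq> cube (k * n)" and F: "F \<in> bool_fun (k * n)" and \<epsilon>: "\<epsilon> > 0" and m: "m > 0"
    and \<theta>: "\<theta> \<in> {- int k..int k + 1}" "advantage D F (vote_hyp n k S \<theta>) \<ge> 2 * \<epsilon>"
  shows "measure_pmf.prob (replicate_pmf m D)
      {ys. advantage D F (vote_hyp n k S (best_threshold n k S (map (\<lambda>x. (x, F x)) ys))) < \<epsilon>}
    \<le> (2 * real k + 2) * (16 / (real m * \<epsilon> ^ 2))"
proof -
  let ?I = "{- int k..int k + 1}"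
  let ?h = "vote_hyp n k S"
  let ?L = "map (\<lambda>x. (x, F x))"
  have fin: "finite (set_pmf D)" using D finite_subset finite_cube by blast
  \<comment> \<open>A deviation below \<open>m * \<epsilon> / 2\<close> suffices: a candidate of
    advantage at least \<open>2 * \<epsilon>\<close> then scores above
    \<open>1.5 * m * \<epsilon>\<close>, one of advantage below \<open>\<epsilon>\<close> scores
    less.\<close>
  define bad where "bad = (\<lambda>\<theta>. {ys. real m * (\<epsilon> / 2) \<le>
      \<bar>(\<Sum>x\<leftarrow>ys. real_of_int (?h \<theta> x * F x)) - real m * advantage D F (?h \<theta>)\<bar>})"
  have score: "real_of_int (score (?L ys) (?h \<theta>)) = (\<Sum>x\<leftarrow>ys. real_of_int (?h \<theta> x * F x))" for ys \<theta>
    by (simp add: score_def comp_def flip: sum_list_of_int)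
  have bad: "measure_pmf.prob (replicate_pmf m D) (bad \<theta>) \<le> 4 / (real m * (\<epsilon> / 2) ^ 2)" for \<theta>
    unfolding bad_def advantage_def
  proof (rule sample_mean_deviation[OF fin])
    fix x assume "x \<in> set_pmf D"
    then have x: "x \<in> cube (k * n)" using D by auto
    then show "\<bar>real_of_int (?h \<theta> x * F x)\<bar> \<le> 1"
      using bool_fun_cases[OF F x] bool_fun_cases[OF vote_hyp_bool_fun[of n k S \<theta>] x] by auto
  qed (use \<epsilon> m in auto)
  have "{ys. advantage D F (?h (best_threshold n k S (?L ys))) < \<epsilon>} \<subseteq> (\<Union>\<theta>\<in>?I. bad \<theta>)"
  proof (rule subsetI, rule ccontr)
    fix ys assume ys: "ys \<in> {ys. advantage D F (?h (best_threshold n k S (?L ys))) < \<epsilon>}"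
      and "ys \<notin> (\<Union>\<theta>\<in>?I. bad \<theta>)"
    then have good: "\<bar>real_of_int (score (?L ys) (?h \<theta>)) - real m * advantage D F (?h \<theta>)\<bar> < real m * (\<epsilon> / 2)"
      if "\<theta> \<in> ?I" for \<theta> using that by (auto simp: bad_def score not_le)
    define b where "b = best_threshold n k S (?L ys)"
    have "b \<in> ?I" "real_of_int (score (?L ys) (?h \<theta>)) \<le> real_of_int (score (?L ys) (?h b))"
      using best_threshold(1)[of n k S "?L ys"] best_threshold(2)[OF \<theta>(1), of "?L ys" n S] by (simp_all add: b_def)
    moreover have "real m * (2 * \<epsilon>) \<le> real m * advantage D F (?h \<theta>)"
      using \<theta>(2) by (intro mult_left_mono) auto
    moreover have "real m * advantage D F (?h b) < real m * \<epsilon>"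
      using ys m by (simp add: b_def)
    ultimately show False using good[OF \<theta>(1)] good[of b] by linarith
  qed
  then have "measure_pmf.prob (replicate_pmf m D) {ys. advantage D F (?h (best_threshold n k S (?L ys))) < \<epsilon>}
      \<le> measure_pmf.prob (replicate_pmf m D) (\<Union>\<theta>\<in>?I. bad \<theta>)"
    by (intro measure_pmf.finite_measure_mono) auto
  also have "\<dots> \<le> (\<Sum>\<theta>\<in>?I. measure_pmf.prob (replicate_pmf m D) (bad \<theta>))"
    by (intro measure_pmf.finite_measure_subadditive_finite) auto
  also have "\<dots> \<le> (\<Sum>\<theta>\<in>?I. 4 / (real m * (\<epsilon> / 2) ^ 2))"
    by (intro sum_mono bad)
  also have "\<dots> = (2 * real k + 2) * (16 / (real m * \<epsilon> ^ 2))"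
    by (simp add: power_divide)
  finally show ?thesis .
qed

section \<open>The vote under a smooth distribution\<close>

locale lift_target =
  fixes n k :: nat and f :: "nat \<Rightarrow> bfun" and D :: "point pmf" and \<kappa> :: real
  assumes k_pos: "k \<ge> 1" and f_balanced: "i < k \<Longrightarrow> balanced n (f i)"
    and kappa: "\<kappa> \<ge> 1" and D_smooth: "smooth \<kappa> (cube (k * n)) D"
begin

abbreviation "\<Omega> \<equiv> cube (k * n)"
abbreviation "ex \<equiv> measure_pmf.expectation D :: (point \<Rightarrow> real) \<Rightarrow> real"

definition F :: bfun where "F = lift_fun n k (majority k) f"
definition tally :: "point \<Rightarrow> int" where "tally X = (\<Sum>i<k. f i (block n X i))"
definition q :: "nat \<Rightarrow> point \<Rightarrow> real" where
  "q i z = ex (\<lambda>X. if block n X i = z then real_of_int (F X) else 0)"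
definition p :: "nat \<Rightarrow> point \<Rightarrow> real" where
  "p i z = measure_pmf.prob D {X. block n X i = z}"
text \<open>The mean number of draws until block \<open>i\<close> equals \<open>z\<close>, capped at
  \<open>2 ^ n\<close>. By \<open>expectation_first_label\<close> the table entry has mean
  \<open>q i z * hit i z\<close>.\<close>

definition hit :: "nat \<Rightarrow> point \<Rightarrow> real" where
  "hit i z = (\<Sum>j<2 ^ n. (1 - p i z) ^ j)"
definition bias :: real where "bias = ex (\<lambda>X. real_of_int (F X))"
definition labelled :: "point list \<Rightarrow> (point \<times> int) list" where
  "labelled xs = map (\<lambda>x. (x, F x)) xs"
definition fl :: "nat \<Rightarrow> point list \<Rightarrow> point \<Rightarrow> real" where
  "fl i xs z = real_of_int (first_label (\<lambda>X. block n X i) (labelled xs) z)"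
text \<open>The mean is taken at a uniform point rather than under \<open>D\<close>, because the
  tail bound uses the independence of the blocks of a uniform point.\<close>

definition mean_vote :: "point list \<Rightarrow> real" where
  "mean_vote xs = (\<Sum>i<k. (\<Sum>z\<in>cube n. fl i xs z) / 2 ^ n)"
text \<open>The correlation of \<open>F\<close> with the recentred vote, see
  \<open>excess_eq\<close>, arranged as a linear form in the table entries.\<close>

definition excess :: "point list \<Rightarrow> real" where
  "excess xs = (\<Sum>i<k. \<Sum>z\<in>cube n. (q i z - bias / 2 ^ n) * fl i xs z)"

lemma support: "set_pmf D \<subseteq> \<Omega>"
  using D_smooth by (simp add: smooth_def)

lemma finite_support: "finite (set_pmf D)"
  by (rule finite_subset[OF support finite_cube])

lemma integrable_D [simp]: "integrable (measure_pmf D) (g :: point \<Rightarrow> real)"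
  by (rule integrable_measure_pmf_finite[OF finite_support])

lemma ex_cong: "(\<And>X. X \<in> \<Omega> \<Longrightarrow> g X = h X) \<Longrightarrow> ex g = ex h"
  using support by (intro integral_cong_AE) (auto simp: AE_measure_pmf_iff)

lemma ex_mono: "(\<And>X. X \<in> \<Omega> \<Longrightarrow> g X \<le> h X) \<Longrightarrow> ex g \<le> ex h"
  using support by (intro expectation_pmf_mono finite_support) auto

text \<open>Change of measure: the density of \<open>D\<close> against the uniform distribution is
  at most \<open>\<kappa>\<close>, so uniform estimates of nonnegative quantities carry over at the
  cost of this factor.\<close>

lemma smooth_expectation:
  assumes "\<And>X. X \<in> \<Omega> \<Longrightarrow> 0 \<le> g X"
  shows "ex g \<le> \<kappa> / 2 ^ (k * n) * (\<Sum>X\<in>\<Omega>. g X)"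
proof -
  have "ex g = (\<Sum>X\<in>\<Omega>. g X * pmf D X)"
    using support by (intro integral_measure_pmf_real) auto
  also have "\<dots> \<le> (\<Sum>X\<in>\<Omega>. g X * (\<kappa> / 2 ^ (k * n)))"
    using D_smooth assms by (intro sum_mono mult_left_mono) (auto simp: smooth_def)
  also have "\<dots> = \<kappa> / 2 ^ (k * n) * (\<Sum>X\<in>\<Omega>. g X)"
    by (subst mult.commute[of _ "sum g \<Omega>"]) (rule sum_distrib_right[symmetric])
  finally show ?thesis .
qed

lemma smooth_prob: "measure_pmf.prob D A \<le> \<kappa> / 2 ^ (k * n) * real (card {X \<in> \<Omega>. X \<in> A})"
  using smooth_expectation[of "indicator A"] by (simp add: indicator_def sum.If_cases Int_def)

lemma F_bool_fun: "F \<in> bool_fun (k * n)"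
  unfolding F_def using f_balanced by (intro lift_fun_bool_fun majority_bool_fun balanced_bool_fun)

lemma F_cases: "X \<in> \<Omega> \<Longrightarrow> F X = -1 \<or> F X = 1"
  using F_bool_fun by (rule bool_fun_cases)

section \<open>The tally of the target and the strength of the signal\<close>

lemma tally_eq: "tally X = (\<Sum>i<k. block_values n k f X i)"
  by (simp add: tally_def block_values_def)

lemma F_eq: "X \<in> \<Omega> \<Longrightarrow> F X = sign_pm (tally X)"
  using block_values_in_cube[of X k n f] f_balanced balanced_bool_fun
  by (auto simp: F_def lift_fun_def majority_def tally_eq)

text \<open>At a uniform point the tally is a simple random walk of \<open>k\<close> steps, by
  \<open>sum_block_values\<close>; a change of measure transfers the small-ball estimate to
  \<open>D\<close>.\<close>

lemma tally_point_prob: "measure_pmf.prob D {X. tally X = s} \<le> \<kappa> / sqrt (real k)"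
proof -
  have "real (card {X \<in> \<Omega>. tally X = s})
      = (\<Sum>X\<in>\<Omega>. (\<lambda>x. if (\<Sum>i<k. x i) = s then 1 else 0) (block_values n k f X))"
    by (simp add: sum.If_cases Int_def tally_eq)
  also have "\<dots> = 2 ^ (k * n) / 2 ^ k * (\<Sum>x\<in>cube k. if (\<Sum>i<k. x i) = s then 1 else 0)"
    using f_balanced by (rule sum_block_values)
  also have "(\<Sum>x\<in>cube k. if (\<Sum>i<k. x i) = s then 1 else 0) = real (card {x \<in> cube k. (\<Sum>i<k. x i) = s})"
    by (simp add: sum.If_cases Int_def)
  also have "2 ^ (k * n) / 2 ^ k * real (card {x \<in> cube k. (\<Sum>i<k. x i) = s})
      \<le> 2 ^ (k * n) / 2 ^ k * (2 ^ k / sqrt (real k))"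
    using card_sum_cube_le[of k s] k_pos by (intro mult_left_mono) (auto simp: field_simps)
  finally have c: "real (card {X \<in> \<Omega>. tally X = s}) \<le> 2 ^ (k * n) / sqrt (real k)" by simp
  have "measure_pmf.prob D {X. tally X = s} \<le> \<kappa> / 2 ^ (k * n) * real (card {X \<in> \<Omega>. tally X = s})"
    using smooth_prob[of "{X. tally X = s}"] by simp
  also have "\<dots> \<le> \<kappa> / 2 ^ (k * n) * (2 ^ (k * n) / sqrt (real k))"
    using kappa by (intro mult_left_mono c) auto
  finally show ?thesis by simp
qed

text \<open>For small \<open>k\<close> the ties of an even \<open>k\<close> may carry most of the mass of \<open>D\<close>. On a tie \<open>F = 1\<close>,
  so this case is excluded by the bound on the bias.\<close>

lemma expectation_abs_tally_ge:
  assumes "bias < 1 / 2"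
  shows "ex (\<lambda>X. \<bar>real_of_int (tally X)\<bar>) \<ge> sqrt (real k) / (16 * \<kappa>)"
proof (cases "sqrt (real k) \<ge> 4 * \<kappa>")
  case True
  \<comment> \<open>At most \<open>2 * t + 1\<close> integers have absolute value at most
    \<open>t\<close>; with this choice their total mass is at most
    \<open>1 / 4 + \<kappa> / sqrt k\<close>, hence at most \<open>1 / 2\<close>.\<close>
  define t where "t = sqrt (real k) / (8 * \<kappa>)"
  have t: "t > 0" using k_pos kappa by (simp add: t_def)
  let ?A = "{X. \<bar>real_of_int (tally X)\<bar> \<le> t}"
  have "?A \<subseteq> (\<Union>s\<in>{- \<lfloor>t\<rfloor>..\<lfloor>t\<rfloor>}. {X. tally X = s})"
  proof
    fix X assume "X \<in> ?A"
    then have "real_of_int \<bar>tally X\<bar> \<le> t" by simp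
    then have "\<bar>tally X\<bar> \<le> \<lfloor>t\<rfloor>" by (simp only: le_floor_iff)
    then show "X \<in> (\<Union>s\<in>{- \<lfloor>t\<rfloor>..\<lfloor>t\<rfloor>}. {X. tally X = s})" by auto
  qed
  then have "measure_pmf.prob D ?A \<le> measure_pmf.prob D (\<Union>s\<in>{- \<lfloor>t\<rfloor>..\<lfloor>t\<rfloor>}. {X. tally X = s})"
    by (intro measure_pmf.finite_measure_mono) auto
  also have "\<dots> \<le> (\<Sum>s\<in>{- \<lfloor>t\<rfloor>..\<lfloor>t\<rfloor>}. measure_pmf.prob D {X. tally X = s})"
    by (intro measure_pmf.finite_measure_subadditive_finite) auto
  also have "\<dots> \<le> (\<Sum>s\<in>{- \<lfloor>t\<rfloor>..\<lfloor>t\<rfloor>}. \<kappa> / sqrt (real k))"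
    by (intro sum_mono tally_point_prob)
  also have "\<dots> = real_of_int (2 * \<lfloor>t\<rfloor> + 1) * (\<kappa> / sqrt (real k))"
    using t by simp
  also have "\<dots> \<le> (2 * t + 1) * (\<kappa> / sqrt (real k))"
    using kappa by (intro mult_right_mono) auto
  also have "\<dots> = 1 / 4 + \<kappa> / sqrt (real k)"
    using kappa k_pos by (simp add: t_def field_simps)
  also have "\<dots> \<le> 1 / 2"
    using True k_pos by (simp add: field_simps)
  finally have A: "measure_pmf.prob D ?A \<le> 1 / 2" .
  have "t / 2 \<le> t * (1 - measure_pmf.prob D ?A)"
    using A t by simp
  also have "\<dots> = ex (\<lambda>X. t * (1 - indicator ?A X))"
    by simp
  also have "\<dots> \<le> ex (\<lambda>X. \<bar>real_of_int (tally X)\<bar>)"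
    using t by (intro ex_mono) (auto simp: indicator_def)
  finally show ?thesis by (simp add: t_def)
next
  case False
  \<comment> \<open>The bound holds pointwise: on a tie \<open>F = 1\<close>, and otherwise twice
    the absolute tally is at least 2 while \<open>F \<ge> -1\<close>.\<close>
  have "1 \<le> ex (\<lambda>X. 2 * \<bar>real_of_int (tally X)\<bar> + real_of_int (F X))"
    using support F_eq
    by (intro expectation_pmf_const_ge finite_support) (fastforce simp: sign_pm_def)
  then have "1 / 4 \<le> ex (\<lambda>X. \<bar>real_of_int (tally X)\<bar>)"
    using assms by (simp add: bias_def)
  moreover have "sqrt (real k) / (16 * \<kappa>) \<le> 1 / 4"
    using False kappa by (simp add: field_simps)
  ultimately show ?thesis by linarith
qed

lemma ex_block:
  assumes "i < k"
  shows "ex (\<lambda>X. real_of_int (F X) * \<phi> (block n X i)) = (\<Sum>z\<in>cube n. q i z * \<phi> z)"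
proof -
  have "ex (\<lambda>X. real_of_int (F X) * \<phi> (block n X i))
      = ex (\<lambda>X. \<Sum>z\<in>cube n. (if block n X i = z then real_of_int (F X) else 0) * \<phi> z)"
  proof (rule ex_cong)
    fix X assume "X \<in> \<Omega>"
    then have "block n X i \<in> cube n" using assms by (rule block_in_cube)
    then have "real_of_int (F X) * \<phi> (block n X i)
        = (\<Sum>z\<in>cube n. if z = block n X i then real_of_int (F X) * \<phi> z else 0)"
      by (simp add: sum.delta)
    also have "\<dots> = (\<Sum>z\<in>cube n. (if block n X i = z then real_of_int (F X) else 0) * \<phi> z)"
      by (intro sum.cong) auto
    finally show "real_of_int (F X) * \<phi> (block n X i) = \<dots>" .
  qed
  also have "\<dots> = (\<Sum>z\<in>cube n. q i z * \<phi> z)"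
    by (simp add: q_def)
  finally show ?thesis .
qed

text \<open>\<open>F\<close> is the sign of the tally, so their product is the absolute tally; its
  summands are integrated block by block with \<open>ex_block\<close>.\<close>

lemma expectation_abs_tally_eq:
  "ex (\<lambda>X. \<bar>real_of_int (tally X)\<bar>) = (\<Sum>i<k. \<Sum>z\<in>cube n. q i z * real_of_int (f i z))"
proof -
  have "ex (\<lambda>X. \<bar>real_of_int (tally X)\<bar>)
      = ex (\<lambda>X. \<Sum>i<k. real_of_int (F X) * real_of_int (f i (block n X i)))"
  proof (rule ex_cong)
    fix X assume X: "X \<in> \<Omega>"
    have "(\<Sum>i<k. real_of_int (F X) * real_of_int (f i (block n X i))) = real_of_int (F X) * real_of_int (tally X)"
      by (simp add: tally_def sum_distrib_left)
    then show "\<bar>real_of_int (tally X)\<bar> = (\<Sum>i<k. real_of_int (F X) * real_of_int (f i (block n X i)))"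
      using F_eq[OF X] by (simp add: sign_pm_def)
  qed
  also have "\<dots> = (\<Sum>i<k. \<Sum>z\<in>cube n. q i z * real_of_int (f i z))"
    using ex_block[of _ "\<lambda>z. real_of_int (f _ z)"] by simp
  finally show ?thesis .
qed

text \<open>Cauchy-Schwarz against the \<open>k * 2 ^ n\<close> values \<open>f i z\<close>, all of
  square 1, applied to the lower bound for the mean absolute tally.\<close>

lemma sum_q_squared_ge:
  assumes "bias < 1 / 2"
  shows "(\<Sum>i<k. \<Sum>z\<in>cube n. q i z ^ 2) \<ge> 1 / (256 * \<kappa> ^ 2 * 2 ^ n)"
proof -
  let ?P = "{..<k} \<times> cube n"
  have "real k / (256 * \<kappa> ^ 2) = (sqrt (real k) / (16 * \<kappa>)) ^ 2"
    by (simp add: power_divide power_mult_distrib)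
  also have "\<dots> \<le> (\<Sum>i<k. \<Sum>z\<in>cube n. q i z * real_of_int (f i z)) ^ 2"
    using expectation_abs_tally_ge[OF assms] kappa unfolding expectation_abs_tally_eq
    by (intro power_mono) auto
  also have "\<dots> = (\<Sum>(i, z)\<in>?P. q i z * real_of_int (f i z)) ^ 2"
    by (simp add: sum.cartesian_product)
  also have "\<dots> \<le> (\<Sum>(i, z)\<in>?P. q i z ^ 2) * (\<Sum>(i, z)\<in>?P. real_of_int (f i z) ^ 2)"
    using Cauchy_Schwarz_ineq_sum[of "\<lambda>(i, z). q i z" "\<lambda>(i, z). real_of_int (f i z)" ?P]
    by (simp add: case_prod_unfold)
  also have "(\<Sum>(i, z)\<in>?P. real_of_int (f i z) ^ 2) = (\<Sum>(i, z)\<in>?P. 1)"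
    using bool_fun_cases[OF balanced_bool_fun[OF f_balanced]] by (intro sum.cong refl) fastforce
  also have "\<dots> = real k * 2 ^ n"
    by (simp add: case_prod_unfold)
  also have "(\<Sum>(i, z)\<in>?P. q i z ^ 2) = (\<Sum>i<k. \<Sum>z\<in>cube n. q i z ^ 2)"
    by (simp add: sum.cartesian_product)
  finally have "real k * (1 / (256 * \<kappa> ^ 2)) \<le> real k * ((\<Sum>i<k. \<Sum>z\<in>cube n. q i z ^ 2) * 2 ^ n)"
    by (simp add: mult_ac)
  then have "1 / (256 * \<kappa> ^ 2) \<le> (\<Sum>i<k. \<Sum>z\<in>cube n. q i z ^ 2) * 2 ^ n"
    using k_pos by (simp only: mult_le_cancel_left_pos of_nat_0_less_iff)
  then have "1 / (256 * \<kappa> ^ 2) / 2 ^ n \<le> (\<Sum>i<k. \<Sum>z\<in>cube n. q i z ^ 2)"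
    by (simp only: pos_divide_le_eq zero_less_power zero_less_numeral)
  then show ?thesis by simp
qed

lemma p_le: "i < k \<Longrightarrow> z \<in> cube n \<Longrightarrow> p i z \<le> \<kappa> / 2 ^ n"
proof -
  assume iz: "i < k" "z \<in> cube n"
  have "p i z \<le> \<kappa> / 2 ^ (k * n) * real (card {X \<in> \<Omega>. block n X i = z})"
    using smooth_prob[of "{X. block n X i = z}"] by (simp add: p_def)
  also have "real (card {X \<in> \<Omega>. block n X i = z}) = 2 ^ (k * n) / 2 ^ n"
    using card_block_eq[OF iz] by (simp add: field_simps)
  finally show ?thesis by simp
qed

lemma p_nonneg: "0 \<le> p i z" and p_le_1: "p i z \<le> 1"
  by (simp_all add: p_def)

lemma abs_q_le: "\<bar>q i z\<bar> \<le> p i z"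
proof -
  have "\<bar>q i z\<bar> \<le> ex (\<lambda>X. \<bar>if block n X i = z then real_of_int (F X) else 0\<bar>)"
    unfolding q_def by (rule integral_abs_bound)
  also have "\<dots> = ex (indicator {X. block n X i = z})"
    using F_cases by (intro ex_cong) (fastforce simp: indicator_def)
  finally show ?thesis by (simp add: p_def)
qed

lemma abs_bias_le: "\<bar>bias\<bar> \<le> 1"
proof -
  have "\<bar>bias\<bar> \<le> ex (\<lambda>X. \<bar>real_of_int (F X)\<bar>)"
    unfolding bias_def by (rule integral_abs_bound)
  also have "\<dots> = ex (\<lambda>X. 1)"
    using F_cases by (intro ex_cong) fastforce
  finally show ?thesis by simp
qed

lemma hit_le: "hit i z \<le> 2 ^ n"
proof -
  have "hit i z \<le> (\<Sum>j<(2::nat) ^ n. 1)"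
    unfolding hit_def using p_nonneg[of i z] p_le_1[of i z] by (intro sum_mono power_le_one) auto
  then show ?thesis by simp
qed

text \<open>By smoothness \<open>p i z \<le> \<kappa> / 2 ^ n\<close>, so Bernoulli's inequality
  keeps the summands with \<open>j\<close> below \<open>2 ^ n / (2 * \<kappa>)\<close> at least
  \<open>1 / 2\<close>.\<close>

lemma hit_ge:
  assumes "i < k" "z \<in> cube n"
  shows "2 ^ n / (4 * \<kappa>) \<le> hit i z"
proof -
  define x where "x = 2 ^ n / (2 * \<kappa>)"
  define r where "r = nat \<lceil>x\<rceil>"
  have x: "0 \<le> x" "x \<le> 2 ^ n" using kappa by (auto simp: x_def field_simps)
  have "\<lceil>x\<rceil> \<le> 2 ^ n" using x(2) by (simp add: ceiling_le_iff)
  then have r: "r \<le> 2 ^ n" by (simp add: r_def nat_le_iff)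
  have half: "1 / 2 \<le> (1 - p i z) ^ j" if "j < r" for j
  proof -
    have "int j < \<lceil>x\<rceil>" using that by (simp add: r_def)
    then have "real j < x" by (simp add: less_ceiling_iff)
    then have "real j * p i z \<le> x * (\<kappa> / 2 ^ n)"
      using p_le[OF assms] p_nonneg[of i z] x by (intro mult_mono) auto
    then have "1 / 2 \<le> 1 + real j * - p i z" using kappa by (simp add: x_def)
    also have "\<dots> \<le> (1 + - p i z) ^ j"
      using p_le_1[of i z] by (intro Bernoulli_inequality) simp
    finally show ?thesis by simp
  qed
  have "2 ^ n / (4 * \<kappa>) = x / 2" by (simp add: x_def)
  also have "\<dots> \<le> (\<Sum>j<r. 1 / 2)" using x by (simp add: r_def)
  also have "\<dots> \<le> (\<Sum>j<r. (1 - p i z) ^ j)" by (intro sum_mono half) auto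
  also have "\<dots> \<le> hit i z"
    unfolding hit_def using r p_le_1[of i z] by (intro sum_mono2) auto
  finally show ?thesis .
qed

section \<open>The recentred vote: mean and concentration\<close>

lemma abs_fl_le:
  assumes "set xs \<subseteq> \<Omega>"
  shows "\<bar>fl i xs z\<bar> \<le> 1"
proof -
  have "\<bar>first_label (\<lambda>X. block n X i) (labelled xs) z\<bar> \<le> 1"
    using assms F_cases by (intro abs_first_label_le) (fastforce simp: labelled_def)
  then show ?thesis by (simp add: fl_def flip: of_int_abs)
qed

lemma vote_eq: "real_of_int (vote n k (labelled xs) X) = (\<Sum>i<k. fl i xs (block n X i))"
  by (simp add: vote_def fl_def)

lemma excess_eq: "excess xs = ex (\<lambda>X. real_of_int (F X) * (real_of_int (vote n k (labelled xs) X) - mean_vote xs))"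
proof -
  have "ex (\<lambda>X. real_of_int (F X) * (real_of_int (vote n k (labelled xs) X) - mean_vote xs))
      = (\<Sum>i<k. ex (\<lambda>X. real_of_int (F X) * fl i xs (block n X i))) - bias * mean_vote xs"
    by (simp add: vote_eq right_diff_distrib sum_distrib_left bias_def)
  also have "\<dots> = (\<Sum>i<k. \<Sum>z\<in>cube n. q i z * fl i xs z) - (\<Sum>i<k. \<Sum>z\<in>cube n. bias / 2 ^ n * fl i xs z)"
    by (simp add: ex_block mean_vote_def sum_distrib_left flip: sum_divide_distrib)
  also have "\<dots> = excess xs"
    by (simp add: excess_def left_diff_distrib sum_subtractf)
  finally show ?thesis by simp
qed

abbreviation "sample \<equiv> replicate_pmf (2 ^ n) D"

lemma finite_sample: "finite (set_pmf sample)"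
  by (rule finite_set_replicate_pmf[OF finite_support])

lemma expectation_excess:
  "measure_pmf.expectation sample excess = (\<Sum>i<k. \<Sum>z\<in>cube n. (q i z - bias / 2 ^ n) * (q i z * hit i z))"
proof -
  have "measure_pmf.expectation sample (\<lambda>xs. fl i xs z) = q i z * hit i z" for i z
    unfolding fl_def labelled_def q_def hit_def p_def by (rule expectation_first_label[OF finite_support])
  then show ?thesis
    unfolding excess_def by (simp add: integrable_measure_pmf_finite[OF finite_sample])
qed

text \<open>The signal \<open>M = \<Sum> q\<^sup>2 hit\<close> is at least of order \<open>\<kappa>\<^sup>-\<^sup>3\<close>, and by Cauchy-Schwarz the correction for the
  mean vote is at most \<open>\<bar>bias\<bar> sqrt (k M)\<close>.\<close>

lemma expectation_excess_ge:
  assumes bias: "bias < 1 / 2" "bias ^ 2 * real k \<le> 1 / (4096 * \<kappa> ^ 3)"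
  shows "measure_pmf.expectation sample excess \<ge> 1 / (2048 * \<kappa> ^ 3)"
proof -
  let ?P = "{..<k} \<times> cube n"
  define M where "M = (\<Sum>i<k. \<Sum>z\<in>cube n. q i z ^ 2 * hit i z)"
  define R where "R = (\<Sum>i<k. \<Sum>z\<in>cube n. q i z * hit i z)"
  have hit0: "0 \<le> hit i z" for i z
    unfolding hit_def using p_le_1[of i z] by (intro sum_nonneg) auto
  have "1 / (1024 * \<kappa> ^ 3) = 1 / (256 * \<kappa> ^ 2 * 2 ^ n) * (2 ^ n / (4 * \<kappa>))"
    by (simp add: power3_eq_cube power2_eq_square)
  also have "\<dots> \<le> (\<Sum>i<k. \<Sum>z\<in>cube n. q i z ^ 2) * (2 ^ n / (4 * \<kappa>))"
    using kappa by (intro mult_right_mono sum_q_squared_ge bias) auto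
  also have "\<dots> \<le> M"
    unfolding M_def sum_distrib_right using hit_ge by (intro sum_mono mult_left_mono) auto
  finally have M: "1 / (1024 * \<kappa> ^ 3) \<le> M" .
  \<comment> \<open>Splitting off \<open>sqrt (hit i z)\<close> lets Cauchy-Schwarz reproduce
    \<open>M\<close> as one factor; the other is at most \<open>k * (2 ^ n) ^ 2\<close> by
    \<open>hit_le\<close>.\<close>
  have "R ^ 2 = (\<Sum>(i, z)\<in>?P. (q i z * sqrt (hit i z)) * sqrt (hit i z)) ^ 2"
    unfolding R_def using hit0 by (simp add: sum.cartesian_product mult.assoc)
  also have "\<dots> \<le> (\<Sum>(i, z)\<in>?P. (q i z * sqrt (hit i z)) ^ 2) * (\<Sum>(i, z)\<in>?P. sqrt (hit i z) ^ 2)"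
    using Cauchy_Schwarz_ineq_sum[of "\<lambda>(i, z). q i z * sqrt (hit i z)" "\<lambda>(i, z). sqrt (hit i z)" ?P]
    by (simp add: case_prod_unfold)
  also have "(\<Sum>(i, z)\<in>?P. (q i z * sqrt (hit i z)) ^ 2) = M"
    unfolding M_def using hit0 by (simp add: sum.cartesian_product power_mult_distrib)
  also have "M * (\<Sum>(i, z)\<in>?P. sqrt (hit i z) ^ 2) \<le> M * (\<Sum>(i, z)\<in>?P. 2 ^ n)"
  proof (intro mult_left_mono sum_mono)
    show "0 \<le> M" using M kappa by (meson order_trans zero_le_divide_1_iff mult_nonneg_nonneg zero_le_numeral zero_le_power zero_le_one)
  qed (use hit0 hit_le in auto)
  also have "\<dots> = M * (real k * (2 ^ n) ^ 2)"
    by (simp add: case_prod_unfold power2_eq_square)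
  finally have R: "R ^ 2 \<le> M * (real k * (2 ^ n) ^ 2)" .
  have M0: "0 \<le> M" using M kappa by (smt (verit) divide_nonneg_nonneg zero_le_power)
  have "(bias / 2 ^ n * R) ^ 2 = bias ^ 2 / (2 ^ n) ^ 2 * R ^ 2"
    by (simp add: power_mult_distrib power_divide)
  also have "\<dots> \<le> bias ^ 2 / (2 ^ n) ^ 2 * (M * (real k * (2 ^ n) ^ 2))"
    by (intro mult_left_mono R) auto
  also have "\<dots> = M * (bias ^ 2 * real k)" by simp
  \<comment> \<open>The assumed bound on the squared bias times \<open>k\<close> is a quarter of the
    lower bound for \<open>M\<close>.\<close>
  also have "\<dots> \<le> M * (M / 4)"
    using bias(2) M M0 by (intro mult_left_mono) auto
  also have "\<dots> = (M / 2) ^ 2" by (simp add: power2_eq_square)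
  finally have "bias / 2 ^ n * R \<le> M / 2"
    by (rule power2_le_imp_le) (use M0 in simp)
  moreover have "measure_pmf.expectation sample excess = M - bias / 2 ^ n * R"
  proof -
    have "(q i z - bias / 2 ^ n) * (q i z * hit i z)
        = q i z ^ 2 * hit i z - bias / 2 ^ n * (q i z * hit i z)" for i z
      by (simp add: power2_eq_square algebra_simps)
    then show ?thesis
      unfolding expectation_excess M_def R_def by (simp only: sum_subtractf sum_distrib_left)
  qed
  ultimately have "M / 2 \<le> measure_pmf.expectation sample excess" by linarith
  then show ?thesis using M by simp
qed

text \<open>In each block at most two table entries change, each by at most 2, and the weights are
  at most \<open>2 * \<kappa> / 2 ^ n\<close>.\<close>

lemma excess_update:
  assumes "set xs \<subseteq> \<Omega>" "x \<in> \<Omega>" "j < length xs"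
  shows "\<bar>excess xs - excess (xs[j := x])\<bar> \<le> 8 * real k * \<kappa> / 2 ^ n"
proof -
  have set': "set (xs[j := x]) \<subseteq> \<Omega>" using assms set_update_subset_insert[of xs j x] by auto
  have w: "\<bar>q i z - bias / 2 ^ n\<bar> \<le> 2 * \<kappa> / 2 ^ n" if "i < k" "z \<in> cube n" for i z
  proof -
    have "\<bar>bias / 2 ^ n\<bar> \<le> \<kappa> / 2 ^ n"
      using abs_bias_le kappa by (simp add: divide_right_mono)
    then show ?thesis using abs_q_le[of i z] p_le[OF that] by linarith
  qed
  have block: "(\<Sum>z\<in>cube n. \<bar>fl i xs z - fl i (xs[j := x]) z\<bar>) \<le> 4" for i
  proof -
    let ?Z = "{block n (xs ! j) i, block n x i}"
    have upd: "labelled (xs[j := x]) = (labelled xs)[j := (x, F x)]"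
      by (simp add: labelled_def map_update)
    have "fl i (xs[j := x]) z = fl i xs z" if "z \<notin> ?Z" for z
      using that assms(3) unfolding fl_def upd
      by (subst first_label_update) (auto simp: labelled_def)
    then have "(\<Sum>z\<in>cube n. \<bar>fl i xs z - fl i (xs[j := x]) z\<bar>)
        = (\<Sum>z\<in>cube n \<inter> ?Z. \<bar>fl i xs z - fl i (xs[j := x]) z\<bar>)"
      by (intro sum.mono_neutral_right) auto
    also have "\<dots> \<le> (\<Sum>z\<in>cube n \<inter> ?Z. 2)"
      using abs_fl_le[OF assms(1)] abs_fl_le[OF set'] by (intro sum_mono) (smt (verit))
    also have "\<dots> \<le> 4"
    proof -
      have "card (cube n \<inter> ?Z) \<le> card ?Z" by (intro card_mono) auto
      also have "\<dots> \<le> 2" by (simp add: card_insert_if)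
      finally show ?thesis by simp
    qed
    finally show ?thesis .
  qed
  have "\<bar>excess xs - excess (xs[j := x])\<bar>
      = \<bar>\<Sum>i<k. \<Sum>z\<in>cube n. (q i z - bias / 2 ^ n) * (fl i xs z - fl i (xs[j := x]) z)\<bar>"
    by (simp add: excess_def sum_subtractf right_diff_distrib)
  also have "\<dots> \<le> (\<Sum>i<k. \<Sum>z\<in>cube n. \<bar>(q i z - bias / 2 ^ n) * (fl i xs z - fl i (xs[j := x]) z)\<bar>)"
    by (intro order_trans[OF sum_abs] sum_mono sum_abs)
  also have "\<dots> \<le> (\<Sum>i<k. \<Sum>z\<in>cube n. 2 * \<kappa> / 2 ^ n * \<bar>fl i xs z - fl i (xs[j := x]) z\<bar>)"
    unfolding abs_mult using w by (intro sum_mono mult_right_mono) auto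
  also have "\<dots> \<le> (\<Sum>i<k. 2 * \<kappa> / 2 ^ n * 4)"
    unfolding sum_distrib_left[symmetric] using kappa by (intro sum_mono mult_left_mono block) auto
  finally show ?thesis by (simp add: mult_ac)
qed

text \<open>The threshold is half of the lower bound for the mean, so a failure is a deviation by
  the other half. The constant is \<open>8 ^ 2 * 4096 ^ 2 = 2 ^ 30\<close>.\<close>

lemma excess_concentration:
  assumes bias: "bias < 1 / 2" "bias ^ 2 * real k \<le> 1 / (4096 * \<kappa> ^ 3)"
  shows "measure_pmf.prob sample {xs. excess xs < 1 / (4096 * \<kappa> ^ 3)} \<le> 2 ^ 30 * real k ^ 2 * \<kappa> ^ 8 / 2 ^ n"
proof -
  let ?t = "1 / (4096 * \<kappa> ^ 3)"
  have t: "?t > 0" using kappa by simp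
  have "{xs. excess xs < ?t} \<subseteq> {xs. ?t \<le> \<bar>excess xs - measure_pmf.expectation sample excess\<bar>}"
    using expectation_excess_ge[OF bias] by (auto simp: abs_if)
  then have "measure_pmf.prob sample {xs. excess xs < ?t}
      \<le> measure_pmf.prob sample {xs. ?t \<le> \<bar>excess xs - measure_pmf.expectation sample excess\<bar>}"
    by (intro measure_pmf.finite_measure_mono) auto
  also have "\<dots> \<le> real (2 ^ n) * (8 * real k * \<kappa> / 2 ^ n) ^ 2 / ?t ^ 2"
    using support by (intro bounded_difference_deviation finite_support t excess_update) auto
  also have "\<dots> = 2 ^ 30 * real k ^ 2 * \<kappa> ^ 8 / 2 ^ n"
    using kappa by (simp add: field_simps power2_eq_square eval_nat_numeral)
  finally show ?thesis .
qed

section \<open>From the recentred vote to a threshold\<close>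

lemma advantage_vote_hyp:
  "advantage D F (vote_hyp n k (labelled xs) \<theta>)
    = ex (\<lambda>X. real_of_int (F X) * real_of_int (sign_pm (vote n k (labelled xs) X - \<theta>)))"
  unfolding advantage_def by (intro ex_cong) (simp add: vote_hyp_def)

lemma abs_vote_le:
  assumes "set xs \<subseteq> \<Omega>"
  shows "\<bar>real_of_int (vote n k (labelled xs) X)\<bar> \<le> real k"
proof -
  have "\<bar>real_of_int (vote n k (labelled xs) X)\<bar> \<le> (\<Sum>i<k. \<bar>fl i xs (block n X i)\<bar>)"
    unfolding vote_eq by (rule sum_abs)
  also have "\<dots> \<le> (\<Sum>i<k. 1)" by (intro sum_mono abs_fl_le assms)
  finally show ?thesis by simp
qed

lemma abs_mean_vote_le:
  assumes "set xs \<subseteq> \<Omega>"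
  shows "\<bar>mean_vote xs\<bar> \<le> real k"
proof -
  have "\<bar>mean_vote xs\<bar> \<le> (\<Sum>i<k. \<bar>(\<Sum>z\<in>cube n. fl i xs z) / 2 ^ n\<bar>)"
    unfolding mean_vote_def by (rule sum_abs)
  also have "\<dots> \<le> (\<Sum>i<k. 1)"
  proof (rule sum_mono)
    fix i
    have "\<bar>\<Sum>z\<in>cube n. fl i xs z\<bar> \<le> (\<Sum>z\<in>cube n. \<bar>fl i xs z\<bar>)" by (rule sum_abs)
    also have "\<dots> \<le> (\<Sum>z\<in>cube n. 1)" by (intro sum_mono abs_fl_le assms)
    finally show "\<bar>(\<Sum>z\<in>cube n. fl i xs z) / 2 ^ n\<bar> \<le> 1" by simp
  qed
  finally show ?thesis by simp
qed

lemma advantage_threshold_low: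
  assumes "set xs \<subseteq> \<Omega>" "\<theta> \<le> - int k"
  shows "advantage D F (vote_hyp n k (labelled xs) \<theta>) = bias"
proof -
  have "sign_pm (vote n k (labelled xs) X - \<theta>) = 1" for X
    using abs_vote_le[OF assms(1), of X] assms(2) by (simp add: sign_pm_def)
  then show ?thesis by (simp add: advantage_vote_hyp bias_def)
qed

lemma advantage_threshold_high:
  assumes "set xs \<subseteq> \<Omega>" "\<theta> \<ge> int k + 1"
  shows "advantage D F (vote_hyp n k (labelled xs) \<theta>) = - bias"
proof -
  have "sign_pm (vote n k (labelled xs) X - \<theta>) = -1" for X
    using abs_vote_le[OF assms(1), of X] assms(2) by (simp add: sign_pm_def)
  then show ?thesis by (simp add: advantage_vote_hyp bias_def)
qed

text \<open>Hoeffding's inequality at a uniform point with the table held fixed, transferred to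
  \<open>D\<close> by smoothness.\<close>

lemma vote_tail:
  assumes xs: "set xs \<subseteq> \<Omega>" and \<tau>: "\<tau> > 0"
  shows "measure_pmf.prob D {X. \<bar>real_of_int (vote n k (labelled xs) X) - mean_vote xs\<bar> > \<tau>}
    \<le> 2 * \<kappa> * exp (- (\<tau> ^ 2 / (2 * real k)))"
proof -
  let ?A = "{X. \<bar>real_of_int (vote n k (labelled xs) X) - mean_vote xs\<bar> > \<tau>}"
  have "real (card {X \<in> \<Omega>. X \<in> ?A}) \<le> 2 ^ (k * n) * (2 * exp (- (\<tau> ^ 2 / (2 * real k))))"
    using cube_hoeffding[of k n "\<lambda>i. fl i xs" \<tau>, OF abs_fl_le[OF xs] \<tau> k_pos]
    by (simp add: vote_eq mean_vote_def)
  then have "\<kappa> / 2 ^ (k * n) * real (card {X \<in> \<Omega>. X \<in> ?A})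
      \<le> \<kappa> / 2 ^ (k * n) * (2 ^ (k * n) * (2 * exp (- (\<tau> ^ 2 / (2 * real k)))))"
    using kappa by (intro mult_left_mono) auto
  then show ?thesis using smooth_prob[of ?A] by simp
qed

text \<open>Clamping the vote to an interval around its mean costs little because of the tail bound,
  and a clamped integer is an average of threshold functions.\<close>

lemma exists_good_threshold:
  assumes xs: "set xs \<subseteq> \<Omega>" and \<tau>: "\<tau> > 0"
    and gap: "\<eta> * (\<tau> + 2) + 4 * real k * \<kappa> * exp (- (\<tau> ^ 2 / (2 * real k))) < excess xs"
  shows "\<exists>\<theta>\<in>{- int k..int k + 1}. advantage D F (vote_hyp n k (labelled xs) \<theta>) \<ge> \<eta>"
proof (rule ccontr)
  assume "\<not> ?thesis"
  then have small: "advantage D F (vote_hyp n k (labelled xs) \<theta>) < \<eta>" if "\<theta> \<in> {- int k..int k + 1}" for \<theta>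
    using that by (auto simp: not_le)
  have bias: "\<bar>bias\<bar> < \<eta>"
    using small[of "- int k"] small[of "int k + 1"]
    by (simp add: advantage_threshold_low[OF xs] advantage_threshold_high[OF xs] abs_less_iff)
  \<comment> \<open>Thresholds outside the candidate range give constant hypotheses of advantage
    \<open>bias\<close> or \<open>- bias\<close>, so the clamping interval may leave the
    range.\<close>
  have adv: "advantage D F (vote_hyp n k (labelled xs) \<theta>) \<le> \<eta>" for \<theta>
    using small[of \<theta>] bias advantage_threshold_low[OF xs, of \<theta>] advantage_threshold_high[OF xs, of \<theta>]
    by (cases "\<theta> \<le> - int k"; cases "\<theta> \<ge> int k + 1") auto
  let ?\<mu> = "mean_vote xs" and ?v = "vote n k (labelled xs)"
  define A where "A = \<lfloor>?\<mu> - \<tau>\<rfloor>"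
  define B where "B = \<lceil>?\<mu> + \<tau>\<rceil>"
  have A: "real_of_int A \<le> ?\<mu> - \<tau>" "?\<mu> - \<tau> < real_of_int A + 1" by (simp_all add: A_def)
  have B: "?\<mu> + \<tau> \<le> real_of_int B" "real_of_int B < ?\<mu> + \<tau> + 1" by (simp_all add: B_def) linarith
  have AB: "A \<le> B" using A B \<tau> by linarith
  define c where "c = (\<lambda>X. max A (min B (?v X)))"
  let ?far = "{X. \<bar>real_of_int (?v X) - ?\<mu>\<bar> > \<tau>}"
  have c_sum: "real_of_int (c X) = (real_of_int A + real_of_int B) / 2
      + (\<Sum>\<theta>\<in>{A<..B}. real_of_int (sign_pm (?v X - \<theta>))) / 2" for X
  proof -
    define w where "w = (\<Sum>\<theta>\<in>{A<..B}. real_of_int (sign_pm (?v X - \<theta>)))"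
    have "2 * c X = A + B + (\<Sum>\<theta>\<in>{A<..B}. sign_pm (?v X - \<theta>))"
      unfolding c_def using AB by (rule clamp_eq_sum_sign)
    then have "real_of_int (2 * c X) = real_of_int (A + B + (\<Sum>\<theta>\<in>{A<..B}. sign_pm (?v X - \<theta>)))" by simp
    then have "2 * real_of_int (c X) = real_of_int A + real_of_int B + w"
      by (simp add: w_def)
    then show ?thesis unfolding w_def[symmetric] by (simp add: field_simps)
  qed
  have "ex (\<lambda>X. real_of_int (F X) * (real_of_int (c X) - ?\<mu>))
      = ((real_of_int A + real_of_int B) / 2 - ?\<mu>) * bias
        + (\<Sum>\<theta>\<in>{A<..B}. advantage D F (vote_hyp n k (labelled xs) \<theta>)) / 2"
  proof -
    have "ex (\<lambda>X. real_of_int (F X) * (real_of_int (c X) - ?\<mu>))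
        = ex (\<lambda>X. ((real_of_int A + real_of_int B) / 2 - ?\<mu>) * real_of_int (F X)
          + (\<Sum>\<theta>\<in>{A<..B}. real_of_int (F X) * real_of_int (sign_pm (?v X - \<theta>))) / 2)"
      unfolding c_sum by (intro ex_cong) (simp add: algebra_simps sum_distrib_left)
    then show ?thesis by (simp add: bias_def advantage_vote_hyp)
  qed
  \<comment> \<open>The midpoint of \<open>A\<close> and \<open>B\<close> is within 1 of the mean
    vote and \<open>\<bar>bias\<bar> < \<eta>\<close>; the sum runs over \<open>B - A\<close>
    thresholds, fewer than \<open>2 * \<tau> + 2\<close>.\<close>
  also have "\<dots> \<le> 1 * \<eta> + (\<Sum>\<theta>\<in>{A<..B}. \<eta>) / 2"
  proof (rule add_mono)
    have "\<bar>(real_of_int A + real_of_int B) / 2 - ?\<mu>\<bar> \<le> 1"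
      using A B by (simp add: abs_le_iff field_simps)
    then have "\<bar>((real_of_int A + real_of_int B) / 2 - ?\<mu>) * bias\<bar> \<le> 1 * \<eta>"
      unfolding abs_mult using bias by (intro mult_mono) auto
    then show "((real_of_int A + real_of_int B) / 2 - ?\<mu>) * bias \<le> 1 * \<eta>" by linarith
  qed (intro divide_right_mono sum_mono adv, simp)
  also have "\<dots> = \<eta> + real_of_int (B - A) / 2 * \<eta>" using AB by simp
  also have "\<dots> \<le> \<eta> + (\<tau> + 1) * \<eta>"
    using A B bias by (intro add_left_mono mult_right_mono) auto
  finally have main: "ex (\<lambda>X. real_of_int (F X) * (real_of_int (c X) - ?\<mu>)) \<le> \<eta> * (\<tau> + 2)"
    by (simp add: algebra_simps)
  have "ex (\<lambda>X. real_of_int (F X) * (real_of_int (?v X) - real_of_int (c X))) \<le> ex (\<lambda>X. 2 * real k * indicator ?far X)"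
  proof (rule ex_mono)
    fix X assume X: "X \<in> \<Omega>"
    have "\<bar>real_of_int (?v X) - real_of_int (c X)\<bar> \<le> 2 * real k * indicator ?far X"
    proof (cases "X \<in> ?far")
      case True
      \<comment> \<open>The mean vote lies between \<open>A\<close> and \<open>B\<close>, so
        clamping moves the vote towards it and never past it.\<close>
      have "\<bar>real_of_int (?v X) - real_of_int (c X)\<bar> \<le> \<bar>real_of_int (?v X) - ?\<mu>\<bar>"
      proof -
        have "real_of_int (c X) = max (real_of_int A) (min (real_of_int B) (real_of_int (?v X)))"
          by (simp add: c_def of_int_max of_int_min)
        then show ?thesis using A B \<tau> by linarith
      qed
      also have "\<dots> \<le> 2 * real k"
        using abs_vote_le[OF xs, of X] abs_mean_vote_le[OF xs] by linarith
      finally show ?thesis using True by simp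
    next
      case False
      then have "real_of_int A \<le> real_of_int (?v X)" "real_of_int (?v X) \<le> real_of_int B"
        using A B by (simp_all add: not_less abs_le_iff)
      then have "c X = ?v X" by (simp add: c_def)
      then show ?thesis by simp
    qed
    moreover have "\<bar>real_of_int (F X) * (real_of_int (?v X) - real_of_int (c X))\<bar> = \<bar>real_of_int (?v X) - real_of_int (c X)\<bar>"
      using F_cases[OF X] by (auto simp: abs_mult)
    ultimately show "real_of_int (F X) * (real_of_int (?v X) - real_of_int (c X)) \<le> 2 * real k * indicator ?far X"
      by linarith
  qed
  also have "\<dots> = 2 * real k * measure_pmf.prob D ?far" by simp
  also have "\<dots> \<le> 2 * real k * (2 * \<kappa> * exp (- (\<tau> ^ 2 / (2 * real k))))"
    by (intro mult_left_mono vote_tail xs \<tau>) auto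
  finally have "ex (\<lambda>X. real_of_int (F X) * (real_of_int (?v X) - real_of_int (c X)))
      \<le> 4 * real k * \<kappa> * exp (- (\<tau> ^ 2 / (2 * real k)))" by simp
  moreover have "excess xs = ex (\<lambda>X. real_of_int (F X) * (real_of_int (c X) - ?\<mu>))
      + ex (\<lambda>X. real_of_int (F X) * (real_of_int (?v X) - real_of_int (c X)))"
    unfolding excess_eq by (subst Bochner_Integration.integral_add[symmetric]) (auto simp: algebra_simps intro!: ex_cong)
  ultimately show False using gap main by linarith
qed

section \<open>Choice of the parameters and success probability\<close>

lemma lg_ge_1: "lg k \<ge> 1"
  by (simp add: lg_def)

lemma le_powr_lg: "real k \<le> 2 powr lg k"
  by (simp add: lg_def)

lemma lg_le: "lg k \<le> real k"
proof (cases "k = 1")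
  case False
  then have "k \<ge> 2" using k_pos by simp
  have "real k \<le> 2 ^ k" by (rule of_nat_less_two_power[THEN less_imp_le])
  then show ?thesis using \<open>k \<ge> 2\<close> by (simp add: lg_def log_le_iff powr_realpow max_def)
qed (simp add: lg_def)

definition rate :: real where "rate = sqrt (real k * lg k * \<kappa> ^ 7)"

text \<open>The width \<open>8 * sqrt (k * lg k * \<kappa>)\<close> makes the exponent
  \<open>32 * lg k * \<kappa>\<close>, which is at least \<open>16 + lg k + 4 * \<kappa>\<close>.
  The three parts absorb the factors \<open>32768\<close>, \<open>k\<close> and
  \<open>\<kappa> ^ 4\<close>.\<close>

lemma tail_numeric:
  "4 * real k * \<kappa> * exp (- ((8 * sqrt (real k * lg k * \<kappa>)) ^ 2 / (2 * real k))) < 1 / (8192 * \<kappa> ^ 3)"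
proof -
  have e: "(8 * sqrt (real k * lg k * \<kappa>)) ^ 2 / (2 * real k) = 32 * (lg k * \<kappa>)"
    using k_pos kappa lg_ge_1 by (simp add: power_mult_distrib)
  have "0 \<le> (lg k - 1) * (\<kappa> - 1)" using kappa lg_ge_1 by simp
  then have "lg k + \<kappa> \<le> lg k * \<kappa> + 1" by (simp add: algebra_simps)
  then have le: "16 + lg k + 4 * \<kappa> \<le> 32 * (lg k * \<kappa>)" using kappa lg_ge_1 by linarith
  have "(32768::real) < exp 16"
  proof -
    have "(2::real) ^ 16 \<le> exp 1 ^ 16" using exp_ge_add_one_self[of "1::real"] by (intro power_mono) auto
    then show ?thesis by (simp flip: exp_of_nat_mult)
  qed
  have "real k \<le> exp (lg k)"
  proof -
    have "2 powr lg k \<le> exp 1 powr lg k" using lg_ge_1 exp_ge_add_one_self[of 1] by (intro powr_mono2) auto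
    also have "\<dots> = exp (lg k)" by (simp add: powr_def)
    finally show ?thesis using le_powr_lg by linarith
  qed
  moreover have "\<kappa> ^ 4 \<le> exp (4 * \<kappa>)"
  proof -
    have "\<kappa> ^ 4 \<le> exp \<kappa> ^ 4" using kappa exp_ge_add_one_self[of \<kappa>] by (intro power_mono) linarith+
    then show ?thesis by (simp flip: exp_of_nat_mult)
  qed
  ultimately have "32768 * (real k * \<kappa> ^ 4) \<le> 32768 * (exp (lg k) * exp (4 * \<kappa>))"
    using kappa by (intro mult_left_mono mult_mono) auto
  also have "\<dots> < exp 16 * (exp (lg k) * exp (4 * \<kappa>))"
    using \<open>32768 < exp 16\<close> by (intro mult_strict_right_mono) auto
  also have "\<dots> = exp (16 + lg k + 4 * \<kappa>)" by (simp add: exp_add)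
  also have "\<dots> \<le> exp (32 * (lg k * \<kappa>))" using le by simp
  finally have "32768 * (real k * \<kappa> ^ 4) < exp (32 * (lg k * \<kappa>))" .
  then have "4 * real k * \<kappa> * 8192 * \<kappa> ^ 3 < exp (32 * (lg k * \<kappa>))"
    by (simp add: eval_nat_numeral mult_ac)
  then show ?thesis
    unfolding e exp_minus using kappa by (simp add: field_simps)
qed

text \<open>With \<open>s\<close> the square root in the width,
  \<open>rate = s * \<kappa> ^ 3\<close> and \<open>8 * s + 2 \<le> 10 * s\<close>, so the claim
  comes down to \<open>10 / 2 ^ 17 < 1 / 2 ^ 13\<close>.\<close>

lemma rate_numeric:
  "1 / (2 ^ 17 * rate) * (8 * sqrt (real k * lg k * \<kappa>) + 2) < 1 / (8192 * \<kappa> ^ 3)"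
proof -
  define s where "s = sqrt (real k * lg k * \<kappa>)"
  have "1 * 1 * 1 \<le> real k * lg k * \<kappa>"
    using k_pos kappa lg_ge_1 by (intro mult_mono) auto
  then have s: "1 \<le> s" unfolding s_def by simp
  have "real k * lg k * \<kappa> ^ 7 = real k * lg k * \<kappa> * (\<kappa> ^ 3) ^ 2"
    by (simp add: eval_nat_numeral)
  moreover have "sqrt ((\<kappa> ^ 3) ^ 2) = \<kappa> ^ 3"
    unfolding real_sqrt_abs using kappa by simp
  ultimately have rate: "rate = s * \<kappa> ^ 3"
    by (simp only: rate_def s_def real_sqrt_mult)
  have "1 / (2 ^ 17 * rate) * (8 * s + 2) \<le> 1 / (2 ^ 17 * rate) * (10 * s)"
    using s kappa by (intro mult_left_mono) (auto simp: rate)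
  also have "\<dots> = 10 / 131072 / \<kappa> ^ 3" using s by (simp add: rate)
  also have "\<dots> < 1 / (8192 * \<kappa> ^ 3)"
    using kappa by (simp add: field_simps)
  finally show ?thesis by (simp add: s_def)
qed

lemma rate_sq: "rate ^ 2 = real k * lg k * \<kappa> ^ 7"
  using lg_ge_1 kappa by (simp add: rate_def)

lemma rate_sq_ge: "real k * \<kappa> ^ 3 \<le> rate ^ 2"
proof -
  have "\<kappa> ^ 3 \<le> \<kappa> ^ 7" using kappa by (intro power_increasing) auto
  then have "real k * 1 * \<kappa> ^ 3 \<le> real k * lg k * \<kappa> ^ 7"
    using kappa lg_ge_1 by (intro mult_mono) auto
  then show ?thesis by (simp only: rate_sq mult_1_right)
qed

lemma rate_ge_1: "rate \<ge> 1"
proof -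
  have "1 * 1 * 1 \<le> real k * lg k * \<kappa> ^ 7"
    using k_pos kappa lg_ge_1 by (intro mult_mono one_le_power) auto
  then show ?thesis by (simp add: rate_def)
qed

text \<open>If \<open>\<bar>bias\<bar>\<close> reaches the required advantage, a constant hypothesis
  among the candidates has it for every sample in the support. Otherwise the bias is small enough
  for \<open>excess_concentration\<close>, and a large excess yields a threshold by
  \<open>exists_good_threshold\<close>.\<close>

lemma no_good_threshold:
  "measure_pmf.prob sample {xs. \<not> (\<exists>\<theta>\<in>{- int k..int k + 1}.
      advantage D F (vote_hyp n k (labelled xs) \<theta>) \<ge> 1 / (2 ^ 17 * rate))}
    \<le> 2 ^ 30 * real k ^ 2 * \<kappa> ^ 8 / 2 ^ n"
proof -
  let ?\<eta> = "1 / (2 ^ 17 * rate)"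
  let ?bad = "{xs. \<not> (\<exists>\<theta>\<in>{- int k..int k + 1}. advantage D F (vote_hyp n k (labelled xs) \<theta>) \<ge> ?\<eta>)}"
  have \<eta>: "?\<eta> > 0" "?\<eta> < 1 / 2" using rate_ge_1 by (simp_all add: field_simps)
  have sup: "set xs \<subseteq> \<Omega>" if "xs \<in> set_pmf sample" for xs
    using that support by (auto simp: set_replicate_pmf)
  show ?thesis
  proof (cases "\<bar>bias\<bar> < ?\<eta>")
    case True
    have "bias ^ 2 * real k \<le> ?\<eta> ^ 2 * real k"
      using True \<eta> by (intro mult_right_mono power2_le_iff_abs_le[THEN iffD2]) auto
    also have "\<dots> = real k / (2 ^ 34 * rate ^ 2)"
      by (simp add: power_divide power_mult_distrib flip: rate_sq)
    also have "\<dots> \<le> real k / (2 ^ 34 * (real k * \<kappa> ^ 3))"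
      using rate_sq_ge rate_ge_1 k_pos kappa by (intro divide_left_mono mult_left_mono mult_pos_pos) auto
    also have "\<dots> \<le> 1 / (4096 * \<kappa> ^ 3)"
      using k_pos kappa by (simp add: field_simps)
    finally have b: "bias ^ 2 * real k \<le> 1 / (4096 * \<kappa> ^ 3)" .
    have "measure_pmf.prob sample ?bad \<le> measure_pmf.prob sample {xs. excess xs < 1 / (4096 * \<kappa> ^ 3)}"
    proof (rule measure_pmf.finite_measure_mono_AE)
      show "AE xs in sample. xs \<in> ?bad \<longrightarrow> xs \<in> {xs. excess xs < 1 / (4096 * \<kappa> ^ 3)}"
        unfolding AE_measure_pmf_iff
      proof (intro ballI impI, rule ccontr)
        fix xs assume xs: "xs \<in> set_pmf sample" "xs \<in> ?bad" "xs \<notin> {xs. excess xs < 1 / (4096 * \<kappa> ^ 3)}"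
        \<comment> \<open>Half of the excess pays for the thresholds, by
          \<open>rate_numeric\<close>, and half for the tail, by
          \<open>tail_numeric\<close>.\<close>
        have "1 / (8192 * \<kappa> ^ 3) + 1 / (8192 * \<kappa> ^ 3) = 1 / (4096 * \<kappa> ^ 3)"
          by (simp add: field_simps)
        then have "?\<eta> * (8 * sqrt (real k * lg k * \<kappa>) + 2)
            + 4 * real k * \<kappa> * exp (- ((8 * sqrt (real k * lg k * \<kappa>)) ^ 2 / (2 * real k))) < excess xs"
          using rate_numeric tail_numeric xs(3) by (simp only: mem_Collect_eq)
        moreover have "8 * sqrt (real k * lg k * \<kappa>) > 0"
          using k_pos kappa lg_ge_1 by simp
        ultimately have "\<exists>\<theta>\<in>{- int k..int k + 1}. advantage D F (vote_hyp n k (labelled xs) \<theta>) \<ge> ?\<eta>"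
          using exists_good_threshold[OF sup[OF xs(1)]] by blast
        then show False using xs(2) by blast
      qed
    qed simp
    also have "\<dots> \<le> 2 ^ 30 * real k ^ 2 * \<kappa> ^ 8 / 2 ^ n"
      using True \<eta>(2) b by (intro excess_concentration) linarith+
    finally show ?thesis .
  next
    case False
    have "AE xs in sample. xs \<notin> ?bad"
      unfolding AE_measure_pmf_iff
    proof
      fix xs assume "xs \<in> set_pmf sample"
      then have "set xs \<subseteq> \<Omega>" by (rule sup)
      then have "?\<eta> \<le> advantage D F (vote_hyp n k (labelled xs) (- int k))
          \<or> ?\<eta> \<le> advantage D F (vote_hyp n k (labelled xs) (int k + 1))"
        using False by (simp add: advantage_threshold_low advantage_threshold_high) linarith
      then show "xs \<notin> ?bad" by auto
    qed
    then have "measure_pmf.prob sample ?bad = 0"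
      by (simp add: measure_pmf.prob_eq_0)
    then show ?thesis using kappa by simp
  qed
qed

text \<open>Validation retains half of the advantage \<open>1 / (2 ^ 17 * rate)\<close>, whence
  \<open>2 ^ 18\<close>. The failure probabilities of the two stages are at most
  \<open>2 ^ 30 * k ^ 2 * \<kappa> ^ 8 / 2 ^ n\<close> and, as \<open>lg k \<le> k\<close>,
  \<open>2 ^ 42 * k ^ 3 * \<kappa> ^ 8 / 2 ^ n\<close>.\<close>

lemma vote_learner_success:
  assumes big: "2 ^ 43 * real k ^ 3 * \<kappa> ^ 8 \<le> \<delta> * 2 ^ n"
  shows "measure_pmf.prob (output_pmf (vote_learner n k) (2 ^ n + 2 ^ n) D F)
      {h. advantage D F h \<ge> 1 / 2 ^ 18 / rate} \<ge> 1 - \<delta>"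
proof -
  let ?\<epsilon> = "1 / 2 ^ 18 / rate"
  let ?h = "\<lambda>xs ys. vote_hyp n k (labelled xs) (best_threshold n k (labelled xs) (labelled ys))"
  let ?bad = "{xs. \<not> (\<exists>\<theta>\<in>{- int k..int k + 1}. advantage D F (vote_hyp n k (labelled xs) \<theta>) \<ge> 1 / (2 ^ 17 * rate))}"
  define r where "r = (2 * real k + 2) * (16 / (real (2 ^ n) * ?\<epsilon> ^ 2))"
  have \<epsilon>: "?\<epsilon> > 0" using rate_ge_1 by simp
  have out: "output_pmf (vote_learner n k) (2 ^ n + 2 ^ n) D F
      = bind_pmf sample (\<lambda>xs. map_pmf (?h xs) sample)"
  proof -
    have "vote_learner n k (labelled (xs @ ys)) = return_pmf (?h xs ys)"
      if "xs \<in> set_pmf sample" for xs ys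
    proof -
      have "length xs = 2 ^ n" using that by (simp add: set_replicate_pmf)
      then show ?thesis by (simp add: vote_learner_def labelled_def Let_def)
    qed
    then show ?thesis
      unfolding output_pmf_def replicate_pmf_distrib map_pmf_def labelled_def[symmetric]
      by (simp add: bind_assoc_pmf bind_return_pmf cong: bind_pmf_cong)
  qed
  have fin: "finite (set_pmf (map_pmf (?h xs) sample))" for xs
    using finite_sample by simp
  have "measure_pmf.prob (output_pmf (vote_learner n k) (2 ^ n + 2 ^ n) D F) {h. advantage D F h < ?\<epsilon>}
      = (\<Sum>xs\<in>set_pmf sample. pmf sample xs * measure_pmf.prob (map_pmf (?h xs) sample) {h. advantage D F h < ?\<epsilon>})"
    unfolding out using finite_sample fin by (intro measure_pmf_bind_finite) auto
  also have "\<dots> \<le> (\<Sum>xs\<in>set_pmf sample. pmf sample xs * (indicator ?bad xs + r))"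
  proof (intro sum_mono mult_left_mono)
    fix xs
    have r0: "r \<ge> 0" by (simp add: r_def)
    show "measure_pmf.prob (map_pmf (?h xs) sample) {h. advantage D F h < ?\<epsilon>} \<le> indicator ?bad xs + r"
    proof (cases "xs \<in> ?bad")
      case True
      then show ?thesis using r0 by (simp add: add_increasing2)
    next
      case False
      then obtain \<theta> where "\<theta> \<in> {- int k..int k + 1}"
        "advantage D F (vote_hyp n k (labelled xs) \<theta>) \<ge> 1 / (2 ^ 17 * rate)" by blast
      then have "measure_pmf.prob sample {ys. advantage D F (?h xs ys) < ?\<epsilon>} \<le> r"
        unfolding r_def labelled_def[of "_ :: point list"]
        using validation[OF support F_bool_fun \<epsilon>, of "2 ^ n" \<theta> "labelled xs"]
        by (simp add: labelled_def)
      then show ?thesis using False by (simp add: vimage_def)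
    qed
  qed simp
  also have "\<dots> = measure_pmf.prob sample ?bad + r"
  proof -
    have "(\<Sum>xs\<in>set_pmf sample. pmf sample xs * indicator ?bad xs) = measure_pmf.prob sample ?bad"
      using integral_measure_pmf_real[OF finite_sample, of sample "indicator ?bad :: _ \<Rightarrow> real"]
      by (simp add: mult.commute)
    moreover have "(\<Sum>xs\<in>set_pmf sample. pmf sample xs * r) = r"
      using sum_pmf_eq_1[OF finite_sample order_refl] by (simp flip: sum_distrib_right)
    ultimately show ?thesis by (simp add: distrib_left sum.distrib)
  qed
  also have "\<dots> \<le> \<delta>"
  proof -
    have k: "1 \<le> real k" using k_pos by simp
    have 1: "real k ^ 2 * \<kappa> ^ 8 \<le> real k ^ 3 * \<kappa> ^ 8"
      using k kappa by (intro mult_right_mono power_increasing) auto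
    have "r = (2 * real k + 2) * (2 ^ 40 * rate ^ 2) / 2 ^ n"
      by (simp add: r_def power_divide power_mult_distrib)
    also have "\<dots> \<le> (4 * real k) * (2 ^ 40 * (real k * real k * \<kappa> ^ 8)) / 2 ^ n"
      unfolding rate_sq using k kappa lg_le lg_ge_1
      by (intro divide_right_mono mult_mono power_increasing) auto
    also have "\<dots> = 2 ^ 42 * (real k ^ 3 * \<kappa> ^ 8) / 2 ^ n"
      by (simp add: power3_eq_cube)
    finally have "measure_pmf.prob sample ?bad + r
        \<le> 2 ^ 30 * (real k ^ 2 * \<kappa> ^ 8) / 2 ^ n + 2 ^ 42 * (real k ^ 3 * \<kappa> ^ 8) / 2 ^ n"
      using no_good_threshold by (simp only: mult.assoc)
    also have "\<dots> = (2 ^ 30 * (real k ^ 2 * \<kappa> ^ 8) + 2 ^ 42 * (real k ^ 3 * \<kappa> ^ 8)) / 2 ^ n"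
      by (rule add_divide_distrib[symmetric])
    also have "\<dots> \<le> 2 ^ 43 * (real k ^ 3 * \<kappa> ^ 8) / 2 ^ n"
    proof (rule divide_right_mono)
      show "2 ^ 30 * (real k ^ 2 * \<kappa> ^ 8) + 2 ^ 42 * (real k ^ 3 * \<kappa> ^ 8) \<le> 2 ^ 43 * (real k ^ 3 * \<kappa> ^ 8)"
      proof -
        have "2 ^ 30 * (real k ^ 2 * \<kappa> ^ 8) \<le> 2 ^ 42 * (real k ^ 3 * \<kappa> ^ 8)"
          using kappa by (intro mult_mono[OF _ 1]) auto
        then show ?thesis by simp
      qed
    qed simp
    also have "\<dots> \<le> \<delta>" using big by (simp add: field_simps)
    finally show ?thesis .
  qed
  finally have "measure_pmf.prob (output_pmf (vote_learner n k) (2 ^ n + 2 ^ n) D F) {h. advantage D F h < ?\<epsilon>} \<le> \<delta>" .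
  moreover have "measure_pmf.prob (output_pmf (vote_learner n k) (2 ^ n + 2 ^ n) D F) {h. advantage D F h \<ge> ?\<epsilon>}
      = 1 - measure_pmf.prob (output_pmf (vote_learner n k) (2 ^ n + 2 ^ n) D F) {h. advantage D F h < ?\<epsilon>}"
    by (subst measure_pmf.prob_compl[symmetric]) (auto intro!: arg_cong[where f = "measure _"])
  ultimately show ?thesis by linarith
qed

end

section \<open>Assembly of the two bounds\<close>

theorem theorem6:
  shows "\<exists>a c b :: real. a > 0 \<and> c > 0 \<and> b > 0 \<and>
    (\<forall>\<kappa> \<delta> :: real. \<kappa> \<ge> 1 \<longrightarrow> 0 < \<delta> \<longrightarrow> \<delta> < 1 \<longrightarrow>
      (\<exists>N > (0 :: real). \<forall>k n :: nat. k \<ge> 1 \<longrightarrow> real n \<ge> N * lg k \<longrightarrow>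
        (\<exists>(m :: nat) A. real m \<le> a * 2 ^ n \<and> is_learner (k * n) A \<and>
          (\<forall>D F. smooth \<kappa> (cube (k * n)) D \<longrightarrow> F \<in> Lift n k (majority k) \<longrightarrow>
            measure_pmf.prob (output_pmf A m D F)
              {h. advantage D F h \<ge> c / sqrt (real k * lg k * \<kappa> ^ 7)} \<ge> 1 - \<delta>)) \<and>
        (\<forall>(m :: nat) A. is_learner (k * n) A \<longrightarrow>
          (\<forall>F \<in> Lift n k (majority k).
            measure_pmf.prob (output_pmf A m (pmf_of_set (cube (k * n))) F)
              {h. accuracy (pmf_of_set (cube (k * n))) F h \<ge> 0.99} \<ge> 1 - \<delta>) \<longrightarrow>
          real m \<ge> b * real k * 2 ^ n)))"
proof (rule exI[of _ 2], rule exI[of _ "1 / 2 ^ 18"], rule exI[of _ "1 / 4"], intro conjI allI impI)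
  fix \<kappa> \<delta> :: real
  assume \<kappa>: "\<kappa> \<ge> 1" and \<delta>: "0 < \<delta>" "\<delta> < 1"
  define u where "u = log 2 (2 ^ 43 * \<kappa> ^ 8 / \<delta>)"
  define v where "v = log 2 (1 / (1 - \<delta>))"
  have "1 * 1 \<le> 2 ^ 43 * \<kappa> ^ 8"
    using \<kappa> by (intro mult_mono one_le_power) auto
  then have "1 \<le> 2 ^ 43 * \<kappa> ^ 8 / \<delta>"
    using \<delta> by (simp add: le_divide_eq)
  then have u: "0 \<le> u" by (simp add: u_def)
  have v: "0 \<le> v" using \<delta> by (simp add: v_def le_divide_eq)
  \<comment> \<open>The learner takes \<open>u\<close> and 3 of the 9, so that \<open>2 ^ n\<close>
    is at least \<open>2 powr u * k ^ 3\<close>. The other 6 and \<open>v\<close> serve the lower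
    bound, which requires \<open>6 \<le> n\<close> and \<open>8 * v \<le> 2 ^ n\<close>. As
    \<open>lg k \<ge> 1\<close>, the factor \<open>lg k\<close> only helps these constants.\<close>
  let ?N = "9 + u + v"
  show "\<exists>N > (0 :: real). \<forall>k n :: nat. k \<ge> 1 \<longrightarrow> real n \<ge> N * lg k \<longrightarrow>
        (\<exists>(m :: nat) A. real m \<le> 2 * 2 ^ n \<and> is_learner (k * n) A \<and>
          (\<forall>D F. smooth \<kappa> (cube (k * n)) D \<longrightarrow> F \<in> Lift n k (majority k) \<longrightarrow>
            measure_pmf.prob (output_pmf A m D F)
              {h. advantage D F h \<ge> 1 / 2 ^ 18 / sqrt (real k * lg k * \<kappa> ^ 7)} \<ge> 1 - \<delta>)) \<and>
        (\<forall>(m :: nat) A. is_learner (k * n) A \<longrightarrow>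
          (\<forall>F \<in> Lift n k (majority k).
            measure_pmf.prob (output_pmf A m (pmf_of_set (cube (k * n))) F)
              {h. accuracy (pmf_of_set (cube (k * n))) F h \<ge> 0.99} \<ge> 1 - \<delta>) \<longrightarrow>
          real m \<ge> 1 / 4 * real k * 2 ^ n)"
  proof (intro exI[of _ ?N] conjI allI impI)
    show "0 < ?N" using u v by simp
    fix k n :: nat
    assume k: "1 \<le> k" and n: "?N * lg k \<le> real n"
    have lg: "1 \<le> lg k" by (simp add: lg_def)
    have "(6 + u + v) * 1 \<le> (6 + u + v) * lg k" using u v lg by (intro mult_left_mono) auto
    then have n': "6 + u + v + 3 * lg k \<le> real n" using n by (simp add: algebra_simps)
    have big: "2 ^ 43 * real k ^ 3 * \<kappa> ^ 8 \<le> \<delta> * 2 ^ n"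
    proof -
      have "real k ^ 3 \<le> (2 powr lg k) ^ 3" using k by (intro power_mono) (auto simp: lg_def)
      also have "\<dots> = 2 powr (3 * lg k)" by (simp add: powr_power mult.commute)
      finally have "(2 ^ 43 * \<kappa> ^ 8 / \<delta>) * real k ^ 3 \<le> 2 powr u * 2 powr (3 * lg k)"
        using \<kappa> \<delta> by (intro mult_mono) (auto simp: u_def)
      also have "\<dots> \<le> 2 powr real n" unfolding powr_add[symmetric] using n' v by (intro powr_mono) auto
      finally show ?thesis using \<delta> by (simp add: powr_realpow field_simps)
    qed
    show "\<exists>(m :: nat) A. real m \<le> 2 * 2 ^ n \<and> is_learner (k * n) A \<and>
          (\<forall>D F. smooth \<kappa> (cube (k * n)) D \<longrightarrow> F \<in> Lift n k (majority k) \<longrightarrow>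
            measure_pmf.prob (output_pmf A m D F)
              {h. advantage D F h \<ge> 1 / 2 ^ 18 / sqrt (real k * lg k * \<kappa> ^ 7)} \<ge> 1 - \<delta>)"
    proof (intro exI[of _ "2 ^ n + 2 ^ n"] exI[of _ "vote_learner n k"] conjI allI impI)
      show "real (2 ^ n + 2 ^ n) \<le> 2 * 2 ^ n" by simp
      show "is_learner (k * n) (vote_learner n k)" by (rule is_learner_vote_learner)
      fix D F assume D: "smooth \<kappa> (cube (k * n)) D" and "F \<in> Lift n k (majority k)"
      then obtain f where f: "\<And>i. i < k \<Longrightarrow> balanced n (f i)" "F = lift_fun n k (majority k) f"
        by (auto simp: Lift_eq)
      interpret lift_target n k f D \<kappa>
        by unfold_locales (use k f(1) \<kappa> D in auto)
      show "1 - \<delta> \<le> measure_pmf.prob (output_pmf (vote_learner n k) (2 ^ n + 2 ^ n) D F)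
          {h. advantage D F h \<ge> 1 / 2 ^ 18 / sqrt (real k * lg k * \<kappa> ^ 7)}"
        using vote_learner_success[OF big] unfolding F_def f(2) rate_def .
    qed
    fix m :: nat and A
    assume "is_learner (k * n) A" and "\<forall>F \<in> Lift n k (majority k).
        measure_pmf.prob (output_pmf A m (pmf_of_set (cube (k * n))) F)
          {h. accuracy (pmf_of_set (cube (k * n))) F h \<ge> 0.99} \<ge> 1 - \<delta>"
    moreover have n6: "6 \<le> n" using n' u v lg by linarith
    moreover have "8 * v \<le> 2 ^ n"
    proof -
      have "8 * n \<le> 2 ^ n" using n6 by (induction n rule: nat_induct_at_least) auto
      then have "8 * real n \<le> 2 ^ n" by (metis of_nat_le_iff of_nat_mult of_nat_numeral of_nat_power)
      then show ?thesis using n' u lg by linarith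
    qed
    ultimately show "1 / 4 * real k * 2 ^ n \<le> real m"
      using k \<delta>(2) by (intro sample_lower_bound[of k \<delta> n A]) (auto simp: v_def)
  qed
qed simp_all

end
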